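(* Let $\deg(x)=1$, $\deg(y)=n$ with $n\ge 1$, and let $d=n\cdot m+r$ with $m\ge 0$ and $r\in\{0,\dots,n-1\}$. The set $\mathrm{Ex}(d)$ of extremal points of the cone $\mathbb{H}(d)$ is given by: (0) for $d\le n-1$: $\mathrm{Ex}(d)=\{h=(1,\dots,1)\ \text{of length}\ \le d+1\}$ (i.e. the all-ones vectors of lengths $1,2,\dots,d+1$); (1) for $r\in\{0,\dots,n-2\}$: $\mathrm{Ex}(d)=\mathrm{Ex}(d-1)\cup\{s^d\}\cup\{t^d\}\cup\{t^d*h : h\in \mathrm{Ex}(d-2r-3)\}$; (2) for $r=n-1$: $\mathrm{Ex}(d)=\mathrm{Ex}(d-1)\cup\{s^d\}$.
   Context: Let $k$ be a field of characteristic zero and $R=k[x,y]$ the graded polynomial ring with $\deg(x)=1$ and $\deg(y)=n$, $n\ge 1$ an integer. For an $\mathbb{N}$-graded $R$-module $M=\bigoplus_{i\ge0}M_i$ the Hilbert function is $h_M(i)=\dim_k M_i$. Only artinian modules that are finitely generated in degree $0$ (graded, generated by finitely many homogeneous elements of degree $0$) are considered; their Hilbert functions have only finitely many nonzero values and are called h-vectors $(h_M(0),h_M(1),\dots)$. $\mathbb{H}\subseteq\bigoplus_{j\in\mathbb{N}}\mathbb{Q}$ is the cone (all finite nonnegative rational linear combinations) generated by the h-vectors of artinian graded $R$-modules finitely generated in degree $0$. For an integer $d\ge 0$, $\mathbb{H}(d)=\mathbb{H}\cap\mathbb{Q}^{d+1}$, the elements supported in degrees $0,\dots,d$. Vectors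 $(h_0,\dots,h_e)$ and $(h_0,\dots,h_e,0,0,\dots)$ are identified. The extremal points of $\mathbb{H}(d)$ are the first (nonzero) integer points on the extremal rays of $\mathbb{H}(d)$; their set is $\mathrm{Ex}(d)$. Convention: $\mathrm{Ex}(e)=\emptyset$ for $e<0$. $s^d$ is the vector $(s_0,\dots,s_d)$ of length $d+1$ with $s_i=\lfloor i/n\rfloor+1$. For $d=n m+r$ with $r\in\{0,\dots,n-1\}$, $t^d$ is the vector of length $d+1$ whose entry in degree $i$ ($0\le i\le d$) is $1$ if $(i \bmod n)\in\{0,\dots,r\}$ and $0$ otherwise. For $d=nm+r$ with $m\ge 0$ and $r\in\{0,\dots,n-1\}$, and $h=(h_0,\dots,h_{nm-r-3})\in\mathbb{H}(nm-r-3)$, define $$t^d*h:=t^d+(\underbrace{0,\dots,0}_{r+1},h_0,\dots,h_{nm-r-3},\underbrace{0,\dots,0}_{r+2}).$$ (Note $nm-r-3=d-2r-3$.) *)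

theory Defs
  imports "Jordan_Normal_Form.VS_Connect" "HOL-Computational_Algebra.Polynomial"
begin

text \<open>
  The polynomial ring \<open>k[x,y]\<close> is the type \<open>'k poly poly\<close>: the coefficient of
  \<open>x^i y^j\<close> in \<open>p\<close> is \<open>coeff (coeff p j) i\<close>, so that \<open>x = [:[:0, 1:]:]\<close>, \<open>y = [:0, 1:]\<close>,
  and the scalar \<open>c\<close> is \<open>[:[:c:]:]\<close>.  It is graded by \<open>deg x = 1\<close>, \<open>deg y = n\<close>.
\<close>

definition homogeneous :: "nat \<Rightarrow> nat \<Rightarrow> 'k::field_char_0 poly poly \<Rightarrow> bool" where
  "homogeneous n e p \<longleftrightarrow> (\<forall>i j. coeff (coeff p j) i \<noteq> 0 \<longrightarrow> i + n * j = e)"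

locale graded_module = Module.module "class_ring :: 'k::field_char_0 poly poly ring" M
  for n :: nat and M :: "('k::field_char_0 poly poly, 'm) module" and G :: "nat \<Rightarrow> 'm set" +
  assumes component_subgroup: "\<And>i. subgroup (G i) (add_monoid M)"
    and direct_sum_components: "\<And>v. v \<in> carrier M \<Longrightarrow>
      \<exists>!f. (\<forall>i. f i \<in> G i) \<and> finite {i. f i \<noteq> \<zero>\<^bsub>M\<^esub>} \<and>
           v = (\<Oplus>\<^bsub>M\<^esub>i\<in>{i. f i \<noteq> \<zero>\<^bsub>M\<^esub>}. f i)"
    and smult_homogeneous: "\<And>e i p v. homogeneous n e p \<Longrightarrow> v \<in> G i \<Longrightarrow> p \<odot>\<^bsub>M\<^esub> v \<in> G (e + i)"

definition (in Module.module) artinian :: bool where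
  "artinian \<longleftrightarrow> (\<forall>N :: nat \<Rightarrow> 'c set.
     (\<forall>i. LinearCombinations.submodule R (N i) M \<and> N (Suc i) \<subseteq> N i) \<longrightarrow> (\<exists>k. \<forall>i\<ge>k. N i = N k))"

definition (in graded_module) fin_gen_degree_0 :: bool where
  "fin_gen_degree_0 \<longleftrightarrow> (\<exists>S. finite S \<and> S \<subseteq> G 0 \<and> span S = carrier M)"

definition component ::
    "('k::field_char_0 poly poly, 'm) module \<Rightarrow> (nat \<Rightarrow> 'm set) \<Rightarrow> nat \<Rightarrow> ('k, 'm) module" where
  "component M G i = \<lparr>carrier = G i, mult = mult M, one = one M, zero = zero M, add = add M,
     smult = (\<lambda>c. smult M [:[:c:]:])\<rparr>"

definition hilbert_function ::
    "('k::field_char_0 poly poly, 'm) module \<Rightarrow> (nat \<Rightarrow> 'm set) \<Rightarrow> nat \<Rightarrow> nat" where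
  "hilbert_function M G i = vectorspace.dim (class_ring :: 'k ring) (component M G i)"

text \<open>
  The carriers range over subsets of the type \<open>(nat \<Rightarrow> 'k poly poly) set\<close>, in which the cosets
  forming a quotient of \<open>R^g\<close> live.  This is no restriction: see \<open>hilbert_function_in_h_vectors\<close>.
\<close>

definition h_vectors :: "'k::field_char_0 itself \<Rightarrow> nat \<Rightarrow> (nat \<Rightarrow> nat) set" where
  "h_vectors _ n = {hilbert_function M G |
     (M :: ('k poly poly, (nat \<Rightarrow> 'k poly poly) set) module) G.
     graded_module n M G \<and> module.artinian (class_ring :: 'k poly poly ring) M \<and>
     graded_module.fin_gen_degree_0 M G}"

lemma (in graded_module) component_subset: "G i \<subseteq> carrier M"
  using subgroup.subset[OF component_subgroup[of i]] by simp

lemma (in graded_module) vectorspace_component: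
  "vectorspace (class_ring :: 'k ring) (component M G i)"
proof (rule vs_criteria)
  show "field (class_ring :: 'k ring)" by (rule class_field.field_axioms)
  note s = subgroup.m_closed[OF component_subgroup[of i], simplified]
    subgroup.one_closed[OF component_subgroup[of i], simplified]
  have sub: "v \<in> G i \<Longrightarrow> v \<in> carrier M" for v using component_subset by auto
  have "homogeneous n 0 [:[:c:]:]" for c :: 'k
    by (auto simp: homogeneous_def coeff_pCons split: nat.splits)
  from smult_homogeneous[OF this] have sm: "v \<in> G i \<Longrightarrow> [:[:c:]:] \<odot>\<^bsub>M\<^esub> v \<in> G i" for c v
    by simp
  have ng: "v \<in> G i \<Longrightarrow> \<exists>w\<in>G i. v \<oplus>\<^bsub>M\<^esub> w = \<zero>\<^bsub>M\<^esub>" for v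
  proof -
    assume v: "v \<in> G i"
    have "inv\<^bsub>add_monoid M\<^esub> v \<in> G i" by (rule subgroup.m_inv_closed[OF component_subgroup v])
    moreover have "v \<oplus>\<^bsub>M\<^esub> inv\<^bsub>add_monoid M\<^esub> v = \<zero>\<^bsub>M\<^esub>"
      using M.r_neg[OF sub[OF v]] by (simp add: a_inv_def)
    ultimately show ?thesis by blast
  qed
  have pl: "[:[:a + b:]:] = [:[:a:]:] + [:[:b:]:]" for a b :: 'k by simp
  have ml: "[:[:a * b:]:] = [:[:a:]:] * [:[:b:]:]" for a b :: 'k by simp
  show "\<zero>\<^bsub>component M G i\<^esub> \<in> carrier (component M G i)" using s by (simp add: component_def)
  show "\<forall>v w. v \<in> carrier (component M G i) \<and> w \<in> carrier (component M G i) \<longrightarrow>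
          v \<oplus>\<^bsub>component M G i\<^esub> w \<in> carrier (component M G i)"
    using s by (simp add: component_def)
  show "\<forall>v\<in>carrier (component M G i). \<exists>neg_v\<in>carrier (component M G i).
          v \<oplus>\<^bsub>component M G i\<^esub> neg_v = \<zero>\<^bsub>component M G i\<^esub>"
    using ng by (simp add: component_def)
  show "\<forall>c v. c \<in> carrier class_ring \<and> v \<in> carrier (component M G i) \<longrightarrow>
          c \<odot>\<^bsub>component M G i\<^esub> v \<in> carrier (component M G i)"
    using sm by (simp add: component_def)
  show "\<forall>v w. v \<in> carrier (component M G i) \<and> w \<in> carrier (component M G i) \<longrightarrow>
          v \<oplus>\<^bsub>component M G i\<^esub> w = w \<oplus>\<^bsub>component M G i\<^esub> v"
    using sub by (auto simp: component_def intro: M.a_comm)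
  show "\<forall>v w x. v \<in> carrier (component M G i) \<and> w \<in> carrier (component M G i) \<and>
          x \<in> carrier (component M G i) \<longrightarrow>
          v \<oplus>\<^bsub>component M G i\<^esub> w \<oplus>\<^bsub>component M G i\<^esub> x =
          v \<oplus>\<^bsub>component M G i\<^esub> (w \<oplus>\<^bsub>component M G i\<^esub> x)"
    using sub by (auto simp: component_def intro: M.a_assoc)
  show "\<forall>v\<in>carrier (component M G i). v \<oplus>\<^bsub>component M G i\<^esub> \<zero>\<^bsub>component M G i\<^esub> = v"
    using sub by (auto simp: component_def)
  show "\<forall>a b v. a \<in> carrier class_ring \<and> b \<in> carrier class_ring \<and> v \<in> carrier (component M G i) \<longrightarrow>
          (a \<otimes>\<^bsub>class_ring\<^esub> b) \<odot>\<^bsub>component M G i\<^esub> v =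
          a \<odot>\<^bsub>component M G i\<^esub> (b \<odot>\<^bsub>component M G i\<^esub> v)"
    using sub smult_assoc1 by (auto simp: component_def ml simp del: mult_pCons_left mult_pCons_right)
  show "\<forall>v\<in>carrier (component M G i). \<one>\<^bsub>class_ring\<^esub> \<odot>\<^bsub>component M G i\<^esub> v = v"
    using sub smult_one by (auto simp: component_def one_pCons)
  show "\<forall>a b v. a \<in> carrier class_ring \<and> b \<in> carrier class_ring \<and> v \<in> carrier (component M G i) \<longrightarrow>
          (a \<oplus>\<^bsub>class_ring\<^esub> b) \<odot>\<^bsub>component M G i\<^esub> v =
          a \<odot>\<^bsub>component M G i\<^esub> v \<oplus>\<^bsub>component M G i\<^esub> b \<odot>\<^bsub>component M G i\<^esub> v"
    using sub smult_l_distr by (auto simp: component_def pl simp del: add_pCons)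
  show "\<forall>a v w. a \<in> carrier class_ring \<and> v \<in> carrier (component M G i) \<and>
          w \<in> carrier (component M G i) \<longrightarrow>
          a \<odot>\<^bsub>component M G i\<^esub> (v \<oplus>\<^bsub>component M G i\<^esub> w) =
          a \<odot>\<^bsub>component M G i\<^esub> v \<oplus>\<^bsub>component M G i\<^esub> a \<odot>\<^bsub>component M G i\<^esub> w"
    using sub smult_r_distr by (auto simp: component_def)
qed

lemma (in mod_hom) hom_finsum:
  assumes "g \<in> A \<rightarrow> carrier M"
  shows "f (\<Oplus>\<^bsub>M\<^esub>a\<in>A. g a) = (\<Oplus>\<^bsub>N\<^esub>a\<in>A. f (g a))"
  using assms
proof (induct A rule: infinite_finite_induct)
  case (insert a A)
  then have "g \<in> A \<rightarrow> carrier M" "g a \<in> carrier M" by auto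
  with insert show ?case by (simp add: Pi_def)
qed auto

lemma (in mod_hom) span_image:
  assumes inj: "inj_on f (carrier M)" and A: "A \<subseteq> carrier M"
  shows "N.span (f ` A) = f ` M.span A"
proof -
  have key: "N.lincomb b (f ` B) = f (M.lincomb (\<lambda>v. b (f v)) B)"
    if B: "B \<subseteq> carrier M" and b: "b \<in> f ` B \<rightarrow> carrier R" for b B
  proof -
    have "N.lincomb b (f ` B) = (\<Oplus>\<^bsub>N\<^esub>v\<in>B. b (f v) \<odot>\<^bsub>N\<^esub> f v)"
      unfolding N.lincomb_def using B b
      by (intro N.M.finsum_reindex) (auto intro!: N.smult_closed inj_on_subset[OF inj])
    also have "\<dots> = (\<Oplus>\<^bsub>N\<^esub>v\<in>B. f (b (f v) \<odot>\<^bsub>M\<^esub> v))"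
      using B b by (intro N.M.finsum_cong') (auto intro!: M.smult_closed f_smult[symmetric])
    also have "\<dots> = f (M.lincomb (\<lambda>v. b (f v)) B)"
      unfolding M.lincomb_def using B b by (intro hom_finsum[symmetric]) auto
    finally show ?thesis .
  qed
  show ?thesis
  proof
    show "N.span (f ` A) \<subseteq> f ` M.span A"
    proof
      fix w assume "w \<in> N.span (f ` A)"
      then obtain C b where C: "w = N.lincomb b C" "finite C" "C \<subseteq> f ` A" "b \<in> C \<rightarrow> carrier R"
        unfolding N.span_def by auto
      from finite_subset_image[OF C(2,3)] obtain B where B: "B \<subseteq> A" "finite B" "C = f ` B" by auto
      have "w = f (M.lincomb (\<lambda>v. b (f v)) B)" using key[of B b] B C A by auto
      moreover have "M.lincomb (\<lambda>v. b (f v)) B \<in> M.span A"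
      proof -
        have "(\<lambda>v. b (f v)) \<in> B \<rightarrow> carrier R" using B C by auto
        then show ?thesis unfolding M.span_def using B by blast
      qed
      ultimately show "w \<in> f ` M.span A" by blast
    qed
    show "f ` M.span A \<subseteq> N.span (f ` A)"
    proof
      fix w assume "w \<in> f ` M.span A"
      then obtain B a where B: "w = f (M.lincomb a B)" "finite B" "B \<subseteq> A" "a \<in> B \<rightarrow> carrier R"
        unfolding M.span_def by auto
      define b where "b = a \<circ> inv_into (carrier M) f"
      have ba: "b (f v) = a v" if "v \<in> B" for v
        using that B A inj by (auto simp: b_def)
      have "M.lincomb (\<lambda>v. b (f v)) B = M.lincomb a B"
        using B A by (intro M.lincomb_cong) (auto simp: ba)
      moreover have b: "b \<in> f ` B \<rightarrow> carrier R" using B ba by auto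
      moreover have "B \<subseteq> carrier M" using B A by auto
      ultimately have "w = N.lincomb b (f ` B)" using key[of B b] B(1) by simp
      moreover have "finite (f ` B)" "f ` B \<subseteq> f ` A" using B by auto
      ultimately show "w \<in> N.span (f ` A)" unfolding N.span_def using b by blast
    qed
  qed
qed

lemma vectorspace_dim_iso:
  assumes "linear_map K V W f" and inj: "inj_on f (carrier V)" and im: "f ` carrier V = carrier W"
  shows "vectorspace.dim K W = vectorspace.dim K V"
proof -
  interpret V: vectorspace K V using assms(1) by (rule linear_map.axioms)
  interpret W: vectorspace K W using assms(1) by (rule linear_map.axioms)
  interpret T: mod_hom K V W f using assms(1) by (rule linear_map.axioms)
  have sp: "W.span (f ` A) = carrier W \<longleftrightarrow> V.span A = carrier V" if A: "A \<subseteq> carrier V" for A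
  proof -
    have "V.span A \<subseteq> carrier V" using A by (auto simp: V.span_def)
    then show ?thesis
      unfolding T.span_image[OF inj A] im[symmetric] using inj by (metis inj_on_image_eq_iff order_refl)
  qed
  have "(\<exists>A. finite A \<and> card A = m \<and> A \<subseteq> carrier W \<and> W.span A = carrier W) \<longleftrightarrow>
        (\<exists>A. finite A \<and> card A = m \<and> A \<subseteq> carrier V \<and> V.span A = carrier V)" (is "?l \<longleftrightarrow> ?r") for m
  proof
    assume ?l
    then obtain A where A: "finite A" "card A = m" "A \<subseteq> f ` carrier V" "W.span A = carrier W"
      using im by auto
    then obtain B where "B \<subseteq> carrier V" "finite B" "A = f ` B" by (meson finite_subset_image)
    with A show ?r using sp inj by (metis card_image inj_on_subset)
  next
    assume ?r
    then obtain A where A: "finite A" "card A = m" "A \<subseteq> carrier V" "V.span A = carrier V" by auto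
    then show ?l using sp inj im by (metis card_image inj_on_subset finite_imageI image_mono)
  qed
  then show ?thesis unfolding V.dim_def W.dim_def by simp
qed

definition transport_module :: "('a, 'm) module \<Rightarrow> ('m \<Rightarrow> 'u) \<Rightarrow> ('a, 'u) module" where
  "transport_module M f = (let g = inv_into (carrier M) f in
     \<lparr>carrier = f ` carrier M, mult = (\<lambda>a b. f \<zero>\<^bsub>M\<^esub>), one = f \<zero>\<^bsub>M\<^esub>, zero = f \<zero>\<^bsub>M\<^esub>,
      add = (\<lambda>a b. f (g a \<oplus>\<^bsub>M\<^esub> g b)), smult = (\<lambda>r a. f (r \<odot>\<^bsub>M\<^esub> g a))\<rparr>)"

lemma transport_mod_hom:
  fixes M :: "('a, 'm) module" and f :: "'m \<Rightarrow> 'u"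
  assumes "Module.module R M" and inj: "inj_on f (carrier M)"
  shows "mod_hom R M (transport_module M f) f"
proof -
  interpret M: Module.module R M by fact
  have 1: "Module.module R (transport_module M f)"
    using inj
    apply (intro module_criteria)
                apply (simp_all add: transport_module_def Let_def M.R.is_cring)
         apply (auto simp: M.a_comm M.a_assoc M.a_lcomm M.smult_assoc1 M.smult_l_distr M.smult_r_distr)
    apply (metis M.r_neg M.a_inv_closed inv_into_f_f)
    done
  show ?thesis
    unfolding mod_hom_def mod_hom_axioms_def LinearCombinations.module_hom_def
    using 1 M.module_axioms inj by (auto simp: transport_module_def Let_def)
qed

lemma h_vector_iso:
  fixes M :: "('k::field_char_0 poly poly, 'm) module" and N :: "('k poly poly, 'u) module"
    and f :: "'m \<Rightarrow> 'u"
  assumes gM: "graded_module n M G"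
    and hom_f: "mod_hom (class_ring :: 'k poly poly ring) M N f"
    and inj: "inj_on f (carrier M)" and car: "carrier N = f ` carrier M"
    and H_def: "H = (\<lambda>i. f ` G i)"
  shows graded_module_iso: "graded_module n N H"
    and artinian_iso: "module.artinian (class_ring :: 'k poly poly ring) M \<Longrightarrow>
      module.artinian (class_ring :: 'k poly poly ring) N"
    and fin_gen_iso: "graded_module.fin_gen_degree_0 M G \<Longrightarrow> graded_module.fin_gen_degree_0 N H"
    and hilbert_function_iso: "hilbert_function N H = hilbert_function M G"
proof -
  let ?R = "class_ring :: 'k poly poly ring"
  interpret A: graded_module n M G by (rule gM)
  interpret T: mod_hom ?R M N f by (rule hom_f)
  define g where "g = inv_into (carrier M) f"
  have gf [simp]: "g (f v) = v" if "v \<in> carrier M" for v using that inj by (simp add: g_def)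
  have fg [simp]: "f (g w) = w" "g w \<in> carrier M" if "w \<in> carrier N" for w
    using that by (auto simp: g_def car f_inv_into_f inv_into_into)
  have sub: "v \<in> G i \<Longrightarrow> v \<in> carrier M" for v i using A.component_subset by auto
  have Hsub: "H i \<subseteq> carrier N" for i using A.component_subset by (auto simp: H_def)
  have gH: "g w \<in> G i" if "w \<in> H i" for w i using that sub by (auto simp: H_def)
  have Ng: "group (add_monoid N)" by (rule T.N.M.a_group)
  have hom: "group_hom (add_monoid M) (add_monoid N) f"
    using Ng A.M.a_group by (auto simp: group_hom_def group_hom_axioms_def hom_def)
  have f0: "f v = \<zero>\<^bsub>N\<^esub> \<longleftrightarrow> v = \<zero>\<^bsub>M\<^esub>" if "v \<in> carrier M" for v
    using that inj T.f0_is_0 A.M.zero_closed by (metis inj_onD)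
  show gr: "graded_module n N H"
  proof (intro graded_module.intro graded_module_axioms.intro)
    show "Module.module ?R N" by (rule T.N.module_axioms)
    show "subgroup (H i) (add_monoid N)" for i
      unfolding H_def by (rule group_hom.subgroup_img_is_subgroup[OF hom A.component_subgroup])
    show "p \<odot>\<^bsub>N\<^esub> w \<in> H (e + i)" if "homogeneous n e p" "w \<in> H i" for e i p w
      using that A.smult_homogeneous[of e p _ i] sub T.f_smult[of p]
      by (auto simp: H_def simp del: T.f_smult) (metis imageI)
    fix w assume w: "w \<in> carrier N"
    let ?P = "\<lambda>(L :: ('k poly poly, 'm) module) (C :: nat \<Rightarrow> 'm set) v h.
       (\<forall>i. h i \<in> C i) \<and> finite {i. h i \<noteq> \<zero>\<^bsub>L\<^esub>} \<and> v = (\<Oplus>\<^bsub>L\<^esub>i\<in>{i. h i \<noteq> \<zero>\<^bsub>L\<^esub>}. h i)"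
    let ?Q = "\<lambda>h. (\<forall>i. h i \<in> H i) \<and> finite {i. h i \<noteq> \<zero>\<^bsub>N\<^esub>} \<and>
        w = (\<Oplus>\<^bsub>N\<^esub>i\<in>{i. h i \<noteq> \<zero>\<^bsub>N\<^esub>}. h i)"
    have QP: "?P M G (g w) (\<lambda>i. g (h i))" if "?Q h" for h
    proof -
      have hN: "h i \<in> carrier N" for i using that Hsub by blast
      have z: "g (h i) \<noteq> \<zero>\<^bsub>M\<^esub> \<longleftrightarrow> h i \<noteq> \<zero>\<^bsub>N\<^esub>" for i
        using f0[of "g (h i)"] hN by simp
      have "f (\<Oplus>\<^bsub>M\<^esub>i\<in>{i. h i \<noteq> \<zero>\<^bsub>N\<^esub>}. g (h i)) = (\<Oplus>\<^bsub>N\<^esub>i\<in>{i. h i \<noteq> \<zero>\<^bsub>N\<^esub>}. f (g (h i)))"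
        using hN by (intro T.hom_finsum) auto
      also have "\<dots> = w" using that hN by simp
      finally have fs: "f (\<Oplus>\<^bsub>M\<^esub>i\<in>{i. h i \<noteq> \<zero>\<^bsub>N\<^esub>}. g (h i)) = w" .
      have "(\<Oplus>\<^bsub>M\<^esub>i\<in>{i. h i \<noteq> \<zero>\<^bsub>N\<^esub>}. g (h i)) \<in> carrier M"
        using hN by (intro A.M.finsum_closed) auto
      from gf[OF this] have gs: "g w = (\<Oplus>\<^bsub>M\<^esub>i\<in>{i. h i \<noteq> \<zero>\<^bsub>N\<^esub>}. g (h i))"
        unfolding fs .
      have "\<forall>i. g (h i) \<in> G i" using that gH by blast
      moreover have "finite {i. h i \<noteq> \<zero>\<^bsub>N\<^esub>}" using that by blast
      ultimately show ?thesis unfolding z using gs by blast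
    qed
    obtain h where h: "?P M G (g w) h" and hu: "\<And>h'. ?P M G (g w) h' \<Longrightarrow> h' = h"
      by (rule ex1E[OF A.direct_sum_components[OF fg(2)[OF w]]]) blast
    have hM: "h i \<in> carrier M" for i using h sub by blast
    have "?Q (\<lambda>i. f (h i))"
    proof -
      have "f (\<Oplus>\<^bsub>M\<^esub>i\<in>{i. h i \<noteq> \<zero>\<^bsub>M\<^esub>}. h i) = (\<Oplus>\<^bsub>N\<^esub>i\<in>{i. h i \<noteq> \<zero>\<^bsub>M\<^esub>}. f (h i))"
        using hM by (intro T.hom_finsum) auto
      then have "w = (\<Oplus>\<^bsub>N\<^esub>i\<in>{i. h i \<noteq> \<zero>\<^bsub>M\<^esub>}. f (h i))" using h fg(1)[OF w] by simp
      moreover have "\<forall>i. f (h i) \<in> H i" using h unfolding H_def by blast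
      moreover have "finite {i. h i \<noteq> \<zero>\<^bsub>M\<^esub>}" using h by blast
      ultimately show ?thesis unfolding f0[OF hM] by blast
    qed
    moreover have "h' = (\<lambda>i. f (h i))" if "?Q h'" for h'
    proof
      fix i
      have "h' i \<in> carrier N" using that Hsub by blast
      from fg(1)[OF this] show "h' i = f (h i)" using fun_cong[OF hu[OF QP[OF that]], of i] by simp
    qed
    ultimately show "\<exists>!h. ?Q h" by (rule ex1I)
  qed
  interpret Ngr: graded_module n N H by (rule gr)
  show "module.artinian ?R N" if art: A.artinian
    unfolding T.N.artinian_def
  proof (intro allI impI)
    fix D assume D: "\<forall>i. LinearCombinations.submodule ?R (D i) N \<and> D (Suc i) \<subseteq> D i"
    have DN: "D i \<subseteq> carrier N" for i
      using D LinearCombinations.submodule.subset by blast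
    have "LinearCombinations.submodule ?R (g ` D i) M" for i
    proof -
      have Di: "LinearCombinations.submodule ?R (D i) N" using D by blast
      note c = LinearCombinations.submodule.m_closed[OF Di] LinearCombinations.submodule.zero_closed[OF Di]
        LinearCombinations.submodule.smult_closed[OF Di]
      have a: "g v \<oplus>\<^bsub>M\<^esub> g w = g (v \<oplus>\<^bsub>N\<^esub> w)" if "v \<in> D i" "w \<in> D i" for v w
      proof -
        have "v \<in> carrier N" "w \<in> carrier N" using DN that by auto
        then show ?thesis using T.f_add[of "g v" "g w"] by (metis A.M.a_closed fg gf)
      qed
      have s: "p \<odot>\<^bsub>M\<^esub> g v = g (p \<odot>\<^bsub>N\<^esub> v)" if "v \<in> D i" for v p
      proof -
        have "v \<in> carrier N" using DN that by auto
        then show ?thesis using T.f_smult[of p "g v"] A.smult_closed[of p "g v"]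
          by (metis UNIV_I fg gf partial_object.select_convs(1))
      qed
      have "\<zero>\<^bsub>M\<^esub> = g \<zero>\<^bsub>N\<^esub>" using T.f0_is_0 A.M.zero_closed by (metis gf)
      then show ?thesis
        using c fg(2)[OF subsetD[OF DN]] by (intro LinearCombinations.submodule.intro A.module_axioms) (auto simp: a s)
    qed
    moreover have "g ` D (Suc i) \<subseteq> g ` D i" for i using D by blast
    ultimately have "\<forall>i. LinearCombinations.submodule ?R (g ` D i) M \<and> g ` D (Suc i) \<subseteq> g ` D i"
      by simp
    with spec[OF art[unfolded A.artinian_def], of "\<lambda>i. g ` D i"]
    obtain k where k: "\<forall>i\<ge>k. g ` D i = g ` D k" by (elim impE exE) simp_all
    have fgD: "f ` g ` D i = D i" for i
    proof -
      have "f ` g ` D i = (\<lambda>w. w) ` D i"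
        unfolding image_image by (intro image_cong refl fg(1) subsetD[OF DN])
      then show ?thesis by simp
    qed
    have "D i = D k" if "i \<ge> k" for i
      using arg_cong[OF mp[OF spec[OF k] that], of "image f"] unfolding fgD .
    then show "\<exists>k. \<forall>i\<ge>k. D i = D k" by blast
  qed
  show "graded_module.fin_gen_degree_0 N H" if fg0: A.fin_gen_degree_0
  proof -
    obtain S where S: "finite S" "S \<subseteq> G 0" "A.span S = carrier M"
      using fg0 unfolding A.fin_gen_degree_0_def by auto
    have "S \<subseteq> carrier M" using S(2) A.component_subset by (rule subset_trans)
    from T.span_image[OF inj this] have "T.N.span (f ` S) = carrier N" unfolding S(3) car .
    moreover have "finite (f ` S)" "f ` S \<subseteq> H 0" using S(1,2) unfolding H_def by auto
    ultimately show ?thesis unfolding Ngr.fin_gen_degree_0_def by blast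
  qed
  show "hilbert_function N H = hilbert_function M G"
  proof
    fix i
    let ?K = "class_ring :: 'k ring"
    have "linear_map ?K (component M G i) (component N H i) f"
    proof (intro linear_map.intro mod_hom.intro mod_hom_axioms.intro)
      show v: "vectorspace ?K (component M G i)" "vectorspace ?K (component N H i)"
        by (rule A.vectorspace_component Ngr.vectorspace_component)+
      show "Module.module ?K (component M G i)" "Module.module ?K (component N H i)"
        using v unfolding vectorspace_def by blast+
      show "f \<in> LinearCombinations.module_hom ?K (component M G i) (component N H i)"
        using sub by (auto simp: LinearCombinations.module_hom_def component_def H_def)
    qed
    moreover have "inj_on f (carrier (component M G i))"
      using inj_on_subset[OF inj A.component_subset] by (simp add: component_def)
    moreover have "f ` carrier (component M G i) = carrier (component N H i)"
      by (simp add: component_def H_def)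
    ultimately show "hilbert_function N H i = hilbert_function M G i"
      unfolding hilbert_function_def by (rule vectorspace_dim_iso)
  qed
qed

theorem (in graded_module) hilbert_function_in_h_vectors:
  assumes artinian and fin_gen_degree_0
  shows "hilbert_function M G \<in> h_vectors TYPE('k) n"
proof -
  obtain S where S: "finite S" "S \<subseteq> G 0" "span S = carrier M"
    using assms unfolding fin_gen_degree_0_def by auto
  have SM: "S \<subseteq> carrier M" using S component_subset by blast
  obtain u :: "'m \<Rightarrow> nat" where u: "inj_on u S"
    using finite_imp_inj_to_nat_seg[OF S(1)] by blast
  define f where "f v = {b :: nat \<Rightarrow> 'k poly poly. v = lincomb (\<lambda>s. b (u s)) S}" for v
  have ne: "f v \<noteq> {}" if v: "v \<in> carrier M" for v
  proof -
    obtain a where a: "v = lincomb a S" using finite_in_span[OF S(1) SM] S(3) v by metis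
    have "lincomb (\<lambda>s. (a \<circ> inv_into S u) (u s)) S = lincomb a S"
      using u SM by (intro lincomb_cong) auto
    then have "a \<circ> inv_into S u \<in> f v" unfolding f_def a by simp
    then show ?thesis by blast
  qed
  have inj: "inj_on f (carrier M)"
  proof (rule inj_onI)
    fix v w assume v: "v \<in> carrier M" and eq: "f v = f w"
    from ne[OF v] obtain b where b: "b \<in> f v" by blast
    with eq have "b \<in> f w" by simp
    with b show "v = w" by (simp add: f_def)
  qed
  have "carrier (transport_module M f) = f ` carrier M" by (simp add: transport_module_def Let_def)
  note t = h_vector_iso[OF graded_module_axioms transport_mod_hom[OF module_axioms inj] inj this refl]
  show ?thesis
    unfolding h_vectors_def
    using t(1) t(2)[OF assms(1)] t(3)[OF assms(2)] t(4)[symmetric] by blast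
qed

definition h_cone :: "'k::field_char_0 itself \<Rightarrow> nat \<Rightarrow> (nat \<Rightarrow> rat) set" where
  "h_cone K n = {v. \<exists>A c. finite A \<and> A \<subseteq> h_vectors K n \<and> (\<forall>h\<in>A. 0 \<le> c h) \<and>
     v = (\<lambda>i. \<Sum>h\<in>A. c h * of_nat (h i))}"

definition h_cone_upto :: "'k::field_char_0 itself \<Rightarrow> nat \<Rightarrow> nat \<Rightarrow> (nat \<Rightarrow> rat) set" where
  "h_cone_upto K n d = {v \<in> h_cone K n. \<forall>i>d. v i = 0}"

definition extremal_ray :: "(nat \<Rightarrow> rat) set \<Rightarrow> (nat \<Rightarrow> rat) set \<Rightarrow> bool" where
  "extremal_ray C \<rho> \<longleftrightarrow>
     (\<exists>v\<in>C. v \<noteq> (\<lambda>_. 0) \<and> \<rho> = {\<lambda>i. t * v i | t. 0 \<le> t}) \<and>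
     (\<forall>a\<in>C. \<forall>b\<in>C. (\<lambda>i. a i + b i) \<in> \<rho> \<longrightarrow> a \<in> \<rho> \<and> b \<in> \<rho>)"

definition integer_points :: "(nat \<Rightarrow> rat) set \<Rightarrow> (nat \<Rightarrow> rat) set" where
  "integer_points \<rho> = {v \<in> \<rho>. v \<noteq> (\<lambda>_. 0) \<and> (\<forall>i. v i \<in> \<int>)}"

definition first_integer_point :: "(nat \<Rightarrow> rat) set \<Rightarrow> (nat \<Rightarrow> rat) \<Rightarrow> bool" where
  "first_integer_point \<rho> v \<longleftrightarrow> v \<in> integer_points \<rho> \<and>
     (\<forall>w\<in>integer_points \<rho>. \<exists>t\<ge>1. w = (\<lambda>i. t * v i))"

text \<open>The index is an integer so that \<open>Ex\<close> can be empty in negative degrees.\<close>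

definition Ex_points :: "'k::field_char_0 itself \<Rightarrow> nat \<Rightarrow> int \<Rightarrow> (nat \<Rightarrow> rat) set" where
  "Ex_points K n e = (if e < 0 then {}
     else {v. \<exists>\<rho>. extremal_ray (h_cone_upto K n (nat e)) \<rho> \<and> first_integer_point \<rho> v})"

definition ones_vec :: "nat \<Rightarrow> nat \<Rightarrow> rat" where
  "ones_vec l i = (if i < l then 1 else 0)"

definition s_vec :: "nat \<Rightarrow> nat \<Rightarrow> nat \<Rightarrow> rat" where
  "s_vec n d i = (if i \<le> d then of_nat (i div n + 1) else 0)"

text \<open>Below, \<open>d mod n\<close> is the \<open>r\<close> of the decomposition \<open>d = n m + r\<close>.\<close>

definition t_vec :: "nat \<Rightarrow> nat \<Rightarrow> nat \<Rightarrow> rat" where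
  "t_vec n d i = (if i \<le> d \<and> i mod n \<le> d mod n then 1 else 0)"

text \<open>The trailing zeros of \<open>t^d * h\<close> come from \<open>h\<close> vanishing in degrees above \<open>d - 2 r - 3\<close>.\<close>

definition t_star :: "nat \<Rightarrow> nat \<Rightarrow> (nat \<Rightarrow> rat) \<Rightarrow> nat \<Rightarrow> rat" where
  "t_star n d h i = t_vec n d i + (if d mod n + 1 \<le> i then h (i - (d mod n + 1)) else 0)"

end

theory Submission
  imports Defs "HOL-Library.Product_Lexorder"
begin

text \<open>
  Everything reduces to monomial ideals.  A \<^emph>\<open>diagram\<close> is a finite set of monomials \<open>x^a y^j\<close>
  closed under divisors; it is the monomial basis of a cyclic quotient of \<open>k[x,y]\<close>, whose Hilbert
  function counts the monomials of the diagram by degree.  Conversely, the standard monomials (for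
  a monomial order) of a module with finitely many generators of degree \<open>0\<close> split into one diagram
  per generator, so every h-vector is a sum of Hilbert functions of diagrams.  Hence
  \<open>h_cone_upto\<close> is generated by the finitely many vectors of diagrams with all degrees at most
  \<open>d\<close> (\<open>h_cone_upto_eq_diagram_cone\<close>).  All these vectors have the entry \<open>1\<close> in degree
  \<open>0\<close>, so the extremal points are exactly those diagram vectors that are not convex combinations
  of others (\<open>extremal_rays_diagram_cone\<close>), and the rest is combinatorics.

  Describe a diagram by its row lengths \<open>b j\<close>, the number of monomials \<open>x^a y^j\<close> it contains; row
  \<open>j\<close> then occupies the degrees from \<open>n j\<close> up to, but excluding, its end \<open>b j + n j\<close>.  Two moves
  write a diagram vector as an average of two others.  If the ends of two consecutive rows decrease,
  the surplus piece of the lower row can be copied to the upper row or deleted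
  (\<open>steep_step_average\<close>).  If the diagram contains a monomial of degree \<open>n m - 1\<close>, where \<open>m\<close> is its
  last row, and its first row does not reach the top degree, then the missing part of the first row
  can be added, or one monomial in each of the same degrees can be removed
  (\<open>triangle_step_average\<close>).  A diagram of top degree \<open>d = n m + r\<close> that admits neither move is
  either the full triangle of all monomials of degree at most \<open>d\<close>, with vector \<open>s^d\<close>, or has nothing
  in degree \<open>n m - 1\<close>.  In the second case its first \<open>r + 1\<close> columns all have height \<open>m + 1\<close>, which
  gives \<open>t^d\<close>; the remaining columns, if there are any, form a smaller diagram, which gives the
  summand \<open>h\<close> of \<open>t^d * h\<close> and must itself be extremal (\<open>extremal_vecs_top\<close>).

  Conversely, \<open>s^d\<close> dominates all diagram vectors entrywise, so it is extremal.  In a convex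
  combination equal to \<open>t^d * h\<close>, every diagram has nothing in degree \<open>n m - 1\<close>, hence at most one
  monomial in degree \<open>d\<close>; the entry \<open>1\<close> in degree \<open>d\<close> forces exactly one, so every diagram has the
  same first \<open>r + 1\<close> columns, and extremality passes from \<open>h\<close> to \<open>t^d * h\<close>
  (\<open>t_star_extremal\<close>).
\<close>


section \<open>Diagrams and their Hilbert functions\<close>

text \<open>
  A diagram is stored through its row lengths: \<open>b j\<close> is the number of monomials \<open>x^a y^j\<close> in
  it, so its elements are the \<open>x^a y^j\<close> with \<open>a < b j\<close>, and row \<open>j\<close> fills the degrees
  \<open>n j, \<dots>, b j + n j - 1\<close>.
\<close>

definition diagrams :: "nat \<Rightarrow> nat \<Rightarrow> (nat \<Rightarrow> nat) set" where
  "diagrams n d = {b. antimono b \<and> 0 < b 0 \<and> (\<forall>j. 0 < b j \<longrightarrow> b j + n * j \<le> d + 1)}"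

definition diagram_count :: "nat \<Rightarrow> (nat \<Rightarrow> nat) \<Rightarrow> nat \<Rightarrow> nat" where
  "diagram_count n b i = card {j. n * j \<le> i \<and> i < b j + n * j}"

definition diagram_vec :: "nat \<Rightarrow> (nat \<Rightarrow> nat) \<Rightarrow> nat \<Rightarrow> rat" where
  "diagram_vec n b i = of_nat (diagram_count n b i)"

definition interval_ind :: "nat \<Rightarrow> nat \<Rightarrow> nat \<Rightarrow> rat" where
  "interval_ind l u i = of_bool (l \<le> i \<and> i < u)"

lemma interval_ind_split: "l \<le> k \<Longrightarrow> k \<le> u \<Longrightarrow> interval_ind l u i = interval_ind l k i + interval_ind k u i"
  by (auto simp: interval_ind_def)

lemma interval_ind_empty [simp]: "interval_ind l l i = 0"
  by (auto simp: interval_ind_def)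

lemma interval_ind_tiling: "(\<Sum>k<m. interval_ind (n * k) (n * k + n) i) = interval_ind 0 (n * m) i"
proof (induction m)
  case (Suc m)
  then show ?case using interval_ind_split[of 0 "n * m" "n * m + n" i] by (simp add: add.commute)
qed simp

lemma finite_rows:
  assumes "1 \<le> n"
  shows "finite {j :: nat. n * j \<le> i \<and> P j}"
proof (rule finite_subset)
  have "j \<le> n * j" for j using assms by simp
  from le_trans[OF this] show "{j. n * j \<le> i \<and> P j} \<subseteq> {..i}" by auto
qed simp

lemma diagram_vec_eq_0_iff:
  assumes "1 \<le> n"
  shows "diagram_vec n b i = 0 \<longleftrightarrow> (\<forall>j. n * j \<le> i \<longrightarrow> b j + n * j \<le> i)"
  using finite_rows[OF assms, of i "\<lambda>j. i < b j + n * j"]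
  by (auto simp: diagram_vec_def diagram_count_def not_less)

lemma diagram_vec_sum:
  assumes "1 \<le> n" "i \<le> J"
  shows "diagram_vec n b i = (\<Sum>j\<le>J. interval_ind (n * j) (b j + n * j) i)"
proof -
  have "j \<le> J" if "n * j \<le> i" for j
  proof -
    have "1 * j \<le> n * j" using assms(1) by (rule mult_le_mono1)
    then show ?thesis using that assms(2) by linarith
  qed
  then have eq: "{j. n * j \<le> i \<and> i < b j + n * j} = {j \<in> {..J}. n * j \<le> i \<and> i < b j + n * j}"
    by auto
  show ?thesis
    unfolding diagram_vec_def diagram_count_def eq interval_ind_def
    by (simp add: of_bool_def sum.If_cases Int_def)
qed

lemma diagram_vec_empty: "1 \<le> n \<Longrightarrow> diagram_vec n (\<lambda>_. 0) = (\<lambda>_. 0)"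
  by (rule ext) (simp add: diagram_vec_eq_0_iff)

lemma diagram_vec_nonneg: "0 \<le> diagram_vec n b i"
  by (simp add: diagram_vec_def)

lemma diagram_vec_0: "b \<in> diagrams n d \<Longrightarrow> 1 \<le> n \<Longrightarrow> diagram_vec n b 0 = 1"
  using diagram_vec_sum[of n 0 0 b] by (auto simp: interval_ind_def diagrams_def)

lemma diagram_vec_above:
  assumes "1 \<le> n" "b \<in> diagrams n d" "d < i"
  shows "diagram_vec n b i = 0"
proof -
  have "b j + n * j \<le> i" if "n * j \<le> i" for j
  proof (cases "b j = 0")
    case False
    then have "b j + n * j \<le> d + 1" using assms(2) by (simp add: diagrams_def)
    then show ?thesis using assms(3) by linarith
  qed (use that in simp)
  then show ?thesis using assms(1) by (simp add: diagram_vec_eq_0_iff)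
qed

section \<open>Two ways of averaging diagrams\<close>

text \<open>
  Rows starting above degree \<open>i\<close> contribute nothing, so the range of summation may be enlarged to
  contain all rows that are altered.
\<close>

lemma diagram_vec_average_rowwise:
  assumes n: "1 \<le> n"
    and eq: "\<And>i J. i \<le> J \<Longrightarrow> k \<le> J \<Longrightarrow>
      (\<Sum>j\<le>J. interval_ind (n * j) (b1 j + n * j) i + interval_ind (n * j) (b2 j + n * j) i
         - 2 * interval_ind (n * j) (b j + n * j) i) = 0"
  shows "diagram_vec n b1 i + diagram_vec n b2 i = 2 * diagram_vec n b i"
proof -
  define J where "J = max i k"
  have J: "i \<le> J" "k \<le> J" by (auto simp: J_def)
  show ?thesis using eq[OF J] unfolding diagram_vec_sum[OF n J(1)]
    by (simp add: sum.distrib sum_subtractf sum_distrib_left)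
qed

text \<open>
  Row \<open>j\<close> ends in a higher degree than row \<open>j + 1\<close>.  The first diagram appends to row
  \<open>j + 1\<close> the degrees between the two ends, the second deletes them from row \<open>j\<close>.
\<close>

lemma steep_step_average:
  assumes n: "1 \<le> n" and steep: "b (Suc j) + n < b j"
  shows "diagram_vec n (b(Suc j := b j - n)) i + diagram_vec n (b(j := b (Suc j) + n)) i
    = 2 * diagram_vec n b i"
proof (rule diagram_vec_average_rowwise[OF n, of "Suc j"])
  fix i J :: nat assume J: "i \<le> J" "Suc j \<le> J"
  let ?F = "\<lambda>k. interval_ind (n * k) ((b(Suc j := b j - n)) k + n * k) i
    + interval_ind (n * k) ((b(j := b (Suc j) + n)) k + n * k) i - 2 * interval_ind (n * k) (b k + n * k) i"
  have "sum ?F {..J} = sum ?F {j, Suc j}"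
    using J by (intro sum.mono_neutral_right) auto
  also have "\<dots> = 0" using steep by (auto simp: interval_ind_def)
  finally show "sum ?F {..J} = 0" .
qed

lemma steep_step_diagrams:
  assumes n: "1 \<le> n" and b: "b \<in> diagrams n d" and steep: "b (Suc j) + n < b j"
  shows "b(Suc j := b j - n) \<in> diagrams n d" "b(j := b (Suc j) + n) \<in> diagrams n d"
    "diagram_vec n (b(Suc j := b j - n)) \<noteq> diagram_vec n b"
proof -
  have anti: "b (Suc k) \<le> b k" for k using b by (auto simp: diagrams_def antimono_def)
  have top: "b k + n * k \<le> d + 1" if "0 < b k" for k using b that by (auto simp: diagrams_def)
  have tj: "b j + n * j \<le> d + 1" using steep by (intro top) simp
  have b0: "0 < b 0" using b by (auto simp: diagrams_def)
  have s: "b (Suc (Suc j)) \<le> b j - n" using anti[of "Suc j"] steep by linarith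
  show "b(Suc j := b j - n) \<in> diagrams n d"
    unfolding diagrams_def
  proof (intro CollectI conjI allI impI)
    show "antimono (b(Suc j := b j - n))"
      using anti s by (auto simp: antimono_iff_le_Suc)
    show "0 < (b(Suc j := b j - n)) 0" using b0 by simp
    show "(b(Suc j := b j - n)) k + n * k \<le> d + 1" if "0 < (b(Suc j := b j - n)) k" for k
      using that top tj steep by (auto split: if_splits)
  qed
  have s2: "b (Suc j) + n \<le> b k" if "j = Suc k" for k using anti[of k] that steep by auto
  show "b(j := b (Suc j) + n) \<in> diagrams n d"
    unfolding diagrams_def
  proof (intro CollectI conjI allI impI)
    show "antimono (b(j := b (Suc j) + n))"
      using anti s2 by (auto simp: antimono_iff_le_Suc)
    show "0 < (b(j := b (Suc j) + n)) 0" using b0 n by simp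
    show "(b(j := b (Suc j) + n)) k + n * k \<le> d + 1" if "0 < (b(j := b (Suc j) + n)) k" for k
      using that top[of k] tj steep by (cases "k = j") auto
  qed
  show "diagram_vec n (b(Suc j := b j - n)) \<noteq> diagram_vec n b"
  proof
    assume eq: "diagram_vec n (b(Suc j := b j - n)) = diagram_vec n b"
    \<comment> \<open>The lowest of the added degrees.\<close>
    define i where "i = b (Suc j) + n * Suc j"
    define J where "J = max i (Suc j)"
    have J: "i \<le> J" "Suc j \<le> J" by (auto simp: J_def)
    let ?F = "\<lambda>k. interval_ind (n * k) ((b(Suc j := b j - n)) k + n * k) i - interval_ind (n * k) (b k + n * k) i"
    have "sum ?F {..J} = 0" using fun_cong[OF eq, of i] unfolding diagram_vec_sum[OF n J(1)]
      by (simp add: sum_subtractf)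
    moreover have "sum ?F {..J} = sum ?F {Suc j}" using J by (intro sum.mono_neutral_right) auto
    moreover have "sum ?F {Suc j} = 1" using steep by (auto simp: interval_ind_def i_def)
    ultimately show False by simp
  qed
qed


text \<open>
  In the first diagram the first row is extended up to the top degree \<open>b m + n m - 1\<close>.  In the
  second, row \<open>k + 1\<close> receives the end that row \<open>k\<close> has in \<open>b\<close>, which shortens it from
  \<open>b (k + 1)\<close> to \<open>b k - n\<close>; if the ends of the rows do not decrease, the deleted pieces lie one behind
  the other and cover each degree from \<open>b 0\<close> to the top exactly once, as the added piece does.  The
  identity below holds for arbitrary ends, by cancellation.  The rows below the last one must have
  length at least \<open>n\<close> for \<open>b k - n\<close> to be an honest difference, whereas the truncation of
  \<open>b m - n\<close> to \<open>0\<close> ends the second diagram at row \<open>m\<close>.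
\<close>

lemma triangle_step_average:
  assumes n: "1 \<le> n" and zero: "\<And>k. m < k \<Longrightarrow> b k = 0" and top: "b m \<le> n"
    and wide: "\<And>k. k < m \<Longrightarrow> n \<le> b k"
  shows "diagram_vec n (b(0 := b m + n * m)) i + diagram_vec n (case_nat (b 0) (\<lambda>k. b k - n)) i
    = 2 * diagram_vec n b i"
proof (rule diagram_vec_average_rowwise[OF n, of "Suc m"])
  fix i J :: nat assume J: "i \<le> J" "Suc m \<le> J"
  let ?b1 = "b(0 := b m + n * m)" and ?b2 = "case_nat (b 0) (\<lambda>k. b k - n)"
  let ?f = "\<lambda>b k. interval_ind (n * k) (b k + n * k) i"
  obtain J' where J': "J = Suc J'" "m \<le> J'" using J(2) by (cases J) auto
  let ?H = "\<lambda>k. interval_ind (n * k + n) (b k - n + (n * k + n)) i - ?f b k"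
  have H: "?H k = - interval_ind (n * k) (n * k + n) i" if "k < m" for k
    using interval_ind_split[of "n * k" "n * k + n" "b k + n * k" i] wide[OF that]
    by (simp add: add.commute add.left_commute)
  have "sum ?H {..J'} = sum ?H {..m}"
    using J' zero by (intro sum.mono_neutral_right) auto
  also have "\<dots> = sum ?H {..<m} + ?H m"
    by (simp add: lessThan_Suc_atMost[symmetric])
  also have "sum ?H {..<m} = - interval_ind 0 (n * m) i"
    unfolding interval_ind_tiling[symmetric] sum_negf[symmetric] by (intro sum.cong) (auto simp: H)
  also have "?H m = - interval_ind (n * m) (b m + n * m) i"
    using top by simp
  finally have HJ: "sum ?H {..J'} = - interval_ind 0 (b m + n * m) i"
    using interval_ind_split[of 0 "n * m" "b m + n * m" i] by simp
  have 1: "(\<Sum>k\<le>J. ?f ?b1 k - ?f b k) = interval_ind 0 (b m + n * m) i - interval_ind 0 (b 0) i"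
  proof -
    have "(\<Sum>k\<le>J. ?f ?b1 k - ?f b k) = (\<Sum>k\<in>{0}. ?f ?b1 k - ?f b k)"
      by (intro sum.mono_neutral_right) auto
    then show ?thesis by simp
  qed
  have 2: "(\<Sum>k\<le>J. ?f ?b2 k) = interval_ind 0 (b 0) i + (\<Sum>k\<le>J'. interval_ind (n * k + n) (b k - n + (n * k + n)) i)"
    unfolding J' sum.atMost_Suc_shift by (simp add: add.commute)
  have 3: "(\<Sum>k\<le>J. ?f b k) = (\<Sum>k\<le>J'. ?f b k)"
    using J' zero by simp
  have "(\<Sum>k\<le>J. ?f ?b1 k + ?f ?b2 k - 2 * ?f b k) =
      (\<Sum>k\<le>J. ?f ?b1 k - ?f b k) + (\<Sum>k\<le>J. ?f ?b2 k) - (\<Sum>k\<le>J. ?f b k)"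
    by (simp add: sum.distrib sum_subtractf sum_distrib_left[symmetric])
  also have "\<dots> = 0" using HJ unfolding 1 2 3 by (simp add: sum_subtractf)
  finally show "(\<Sum>k\<le>J. ?f ?b1 k + ?f ?b2 k - 2 * ?f b k) = 0" .
qed

lemma triangle_step_diagrams:
  assumes n: "1 \<le> n" and b: "b \<in> diagrams n d" and zero: "\<And>k. m < k \<Longrightarrow> b k = 0"
    and top: "b m + n * m = d + 1" and wide: "\<And>k. k < m \<Longrightarrow> n \<le> b k" and short: "b 0 < d + 1"
    and le: "b m \<le> n"
  shows "b(0 := b m + n * m) \<in> diagrams n d" "case_nat (b 0) (\<lambda>k. b k - n) \<in> diagrams n d"
    "diagram_vec n (b(0 := b m + n * m)) \<noteq> diagram_vec n b"
proof -
  have anti: "b (Suc k) \<le> b k" for k using b by (auto simp: diagrams_def antimono_def)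
  have bd: "0 < b k \<Longrightarrow> b k + n * k \<le> d + 1" for k using b by (auto simp: diagrams_def)
  have b0: "0 < b 0" using b by (auto simp: diagrams_def)
  show "b(0 := b m + n * m) \<in> diagrams n d"
    using le_trans[OF anti[of 0], of "d + 1"] anti bd top short by (auto simp: diagrams_def antimono_iff_le_Suc)
  have "b k - n + n * Suc k \<le> d + 1" if "n < b k" for k
    using bd[of k] that by simp
  then show "case_nat (b 0) (\<lambda>k. b k - n) \<in> diagrams n d"
    using anti b0 short by (auto simp: diagrams_def antimono_iff_le_Suc diff_le_mono split: nat.splits)
  show "diagram_vec n (b(0 := b m + n * m)) \<noteq> diagram_vec n b"
  proof
    assume eq: "diagram_vec n (b(0 := b m + n * m)) = diagram_vec n b"
    let ?F = "\<lambda>k. interval_ind (n * k) ((b(0 := b m + n * m)) k + n * k) (b 0) - interval_ind (n * k) (b k + n * k) (b 0)"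
    have "sum ?F {..b 0} = 0" using fun_cong[OF eq, of "b 0"]
      unfolding diagram_vec_sum[OF n order_refl] by (simp add: sum_subtractf)
    moreover have "sum ?F {..b 0} = sum ?F {0}" by (intro sum.mono_neutral_right) auto
    moreover have "sum ?F {0} = 1" using top short by (auto simp: interval_ind_def)
    ultimately show False by simp
  qed
qed

section \<open>Triangles and towers\<close>

lemma diagram_vec_triangle:
  assumes n: "1 \<le> n" and b: "\<And>j. b j = d + 1 - n * j"
  shows "diagram_vec n b = s_vec n d"
proof
  fix i
  show "diagram_vec n b i = s_vec n d i"
  proof (cases "i \<le> d")
    case True
    have "{j. n * j \<le> i \<and> i < b j + n * j} = {..i div n}"
      using True n b by (auto simp: less_eq_div_iff_mult_less_eq mult.commute)
    then show ?thesis using True by (simp add: diagram_vec_def diagram_count_def s_vec_def)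
  next
    case False
    then have "diagram_vec n b i = 0" using n b by (auto simp: diagram_vec_eq_0_iff)
    then show ?thesis using False by (simp add: s_vec_def)
  qed
qed

lemma diagram_vec_le_s_vec:
  assumes n: "1 \<le> n" and b: "b \<in> diagrams n d"
  shows "diagram_vec n b i \<le> s_vec n d i"
proof (cases "i \<le> d")
  case True
  have "{j. n * j \<le> i \<and> i < b j + n * j} \<subseteq> {..i div n}"
    using n by (auto simp: less_eq_div_iff_mult_less_eq mult.commute)
  from card_mono[OF _ this] show ?thesis
    using True by (simp add: diagram_vec_def diagram_count_def s_vec_def flip: of_nat_Suc)
next
  case False
  then show ?thesis using diagram_vec_above[OF n b] by (simp add: s_vec_def)
qed

text \<open>
  Cut the diagram behind its first \<open>r + 1\<close> columns.  These have height \<open>m + 1\<close> and contribute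
  \<open>t^d\<close>; the columns behind them form the diagram with row lengths \<open>b j - (r + 1)\<close>, shifted by
  \<open>r + 1\<close> degrees.
\<close>

lemma t_star_diagram:
  assumes n: "1 \<le> n" and d: "d = n * m + r" and r: "r < n"
    and le: "\<And>j. j \<le> m \<Longrightarrow> r + 1 \<le> b j" and zero: "\<And>j. m < j \<Longrightarrow> b j = 0"
  shows "diagram_vec n b = t_star n d (diagram_vec n (\<lambda>j. b j - (r + 1)))"
proof
  fix i
  let ?c = "\<lambda>j. b j - (r + 1)"
  define J where "J = max i m"
  have J: "i \<le> J" "m \<le> J" by (auto simp: J_def)
  have dm: "d div n = m" "d mod n = r" using d r by auto
  \<comment> \<open>Only row \<open>i div n\<close> of the first \<open>r + 1\<close> columns can contain a monomial of degree \<open>i\<close>, because \<open>r < n\<close>.\<close>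
  have "t_vec n d i = interval_ind (n * (i div n)) (n * (i div n) + (r + 1)) i * of_bool (i div n \<le> m)"
  proof -
    have i: "i = n * (i div n) + i mod n" by simp
    have "i \<le> d \<and> i mod n \<le> r \<longleftrightarrow> i div n \<le> m \<and> i mod n \<le> r"
    proof (safe)
      assume "i \<le> d" then show "i div n \<le> m" using div_le_mono[of i d n] dm by simp
    next
      assume "i div n \<le> m" "i mod n \<le> r"
      then have "n * (i div n) + i mod n \<le> n * m + r" by (intro add_mono mult_le_mono2)
      then show "i \<le> d" using d by simp
    qed
    moreover have "i mod n \<le> r \<longleftrightarrow> i < n * (i div n) + (r + 1)" by (subst (2) i) linarith
    moreover have "n * (i div n) \<le> i" by simp
    ultimately show ?thesis by (auto simp: t_vec_def interval_ind_def dm simp del: mult_div_mod_eq)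
  qed
  also have "\<dots> = (\<Sum>j\<le>J. interval_ind (n * j) (n * j + (r + 1)) i * of_bool (j \<le> m))"
  proof -
    have "i div n \<le> J" using J(1) by (meson div_le_dividend le_trans)
    moreover have "interval_ind (n * j) (n * j + (r + 1)) i = 0" if "j \<noteq> i div n" for j
    proof (rule ccontr)
      assume "interval_ind (n * j) (n * j + (r + 1)) i \<noteq> 0"
      then have "n * j \<le> i \<and> i < n * j + (r + 1)" by (simp add: interval_ind_def split: if_splits)
      then have "i div n = j" using r by (intro div_nat_eqI) (auto simp: mult.commute)
      then show False using that by simp
    qed
    ultimately have "(\<Sum>j\<le>J. interval_ind (n * j) (n * j + (r + 1)) i * of_bool (j \<le> m)) =
      (\<Sum>j\<in>{i div n}. interval_ind (n * j) (n * j + (r + 1)) i * of_bool (j \<le> m))"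
      by (intro sum.mono_neutral_right) auto
    then show ?thesis by simp
  qed
  finally have t: "t_vec n d i = (\<Sum>j\<le>J. interval_ind (n * j) (n * j + (r + 1)) i * of_bool (j \<le> m))" .
  have c: "(if r + 1 \<le> i then diagram_vec n ?c (i - (r + 1)) else 0) =
     (\<Sum>j\<le>J. interval_ind (n * j + (r + 1)) (?c j + n * j + (r + 1)) i)"
  proof (cases "r + 1 \<le> i")
    case True
    have "i - (r + 1) \<le> J" using J by simp
    have "interval_ind (n * j) (?c j + n * j) (i - (r + 1)) =
        interval_ind (n * j + (r + 1)) (?c j + n * j + (r + 1)) i" for j
      using True by (auto simp: interval_ind_def)
    with diagram_vec_sum[OF n \<open>i - (r + 1) \<le> J\<close>, of ?c] True show ?thesis by simp
  next
    case False
    then show ?thesis by (auto simp: interval_ind_def intro!: sum.neutral[symmetric])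
  qed
  have "interval_ind (n * j) (b j + n * j) i = interval_ind (n * j) (n * j + (r + 1)) i * of_bool (j \<le> m)
      + interval_ind (n * j + (r + 1)) (?c j + n * j + (r + 1)) i" for j
  proof (cases "j \<le> m")
    case True
    then show ?thesis using le[of j] interval_ind_split[of "n * j" "n * j + (r + 1)" "b j + n * j" i]
      by simp
  next
    case False
    then show ?thesis using zero by simp
  qed
  then show "diagram_vec n b i = t_star n d (diagram_vec n ?c) i"
    unfolding t_star_def dm c t diagram_vec_sum[OF n J(1)] by (simp add: sum.distrib)
qed


section \<open>Extremal vectors of diagrams\<close>

lemma finite_diagrams:
  assumes n: "1 \<le> n"
  shows "finite (diagrams n d)"
proof (rule finite_subset)
  show "diagrams n d \<subseteq> {b. \<forall>j. (j \<in> {..d} \<longrightarrow> b j \<in> {..d + 1}) \<and> (j \<notin> {..d} \<longrightarrow> b j = 0)}"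
  proof
    fix b assume b: "b \<in> diagrams n d"
    have "b j \<le> d + 1 \<and> (d < j \<longrightarrow> b j = 0)" for j
    proof (cases "b j = 0")
      case False
      then have "b j + n * j \<le> d + 1" using b by (auto simp: diagrams_def)
      moreover have "j \<le> n * j" using n by simp
      ultimately show ?thesis using False by linarith
    qed simp
    then show "b \<in> {b. \<forall>j. (j \<in> {..d} \<longrightarrow> b j \<in> {..d + 1}) \<and> (j \<notin> {..d} \<longrightarrow> b j = 0)}"
      by auto
  qed
  show "finite {b. \<forall>j. (j \<in> {..d} \<longrightarrow> b j \<in> {..d + 1}) \<and> (j \<notin> {..d} \<longrightarrow> b j = 0)}"
    by (rule finite_set_of_finite_funs) auto
qed

definition diagram_cone :: "nat \<Rightarrow> nat \<Rightarrow> (nat \<Rightarrow> rat) set" where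
  "diagram_cone n d = {\<lambda>i. \<Sum>b\<in>diagrams n d. c b * diagram_vec n b i | c. \<forall>b. 0 \<le> c b}"

text \<open>
  All diagram vectors have the entry \<open>1\<close> in degree \<open>0\<close>, so proportional ones are equal.  A diagram
  vector therefore spans an extremal ray exactly if all diagrams with a positive coefficient in a
  nonnegative combination representing it have this same vector.
\<close>

definition extremal_vecs :: "nat \<Rightarrow> nat \<Rightarrow> (nat \<Rightarrow> rat) set" where
  "extremal_vecs n d = {v \<in> diagram_vec n ` diagrams n d.
     \<forall>c. (\<forall>b. 0 \<le> c b) \<longrightarrow> v = (\<lambda>i. \<Sum>b\<in>diagrams n d. c b * diagram_vec n b i) \<longrightarrow>
       (\<forall>b\<in>diagrams n d. 0 < c b \<longrightarrow> diagram_vec n b = v)}"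

lemma sum_diagrams_regroup:
  assumes n: "1 \<le> n" and A: "finite A" "f ` A \<subseteq> diagrams n d"
  shows "(\<Sum>x\<in>A. a x * diagram_vec n (f x) i) =
    (\<Sum>b\<in>diagrams n d. (\<Sum>x\<in>{x \<in> A. f x = b}. a x) * diagram_vec n b i)"
proof -
  have "(\<Sum>x\<in>A. a x * diagram_vec n (f x) i) =
     (\<Sum>b\<in>diagrams n d. \<Sum>x\<in>{x \<in> A. f x = b}. a x * diagram_vec n (f x) i)"
    using sum.group[OF A(1) finite_diagrams[OF n] A(2), of "\<lambda>x. a x * diagram_vec n (f x) i"] by simp
  then show ?thesis by (simp add: sum_distrib_right)
qed

text \<open>
  The form in which extremality is used: the combination may be indexed by any finite family of
  diagrams, possibly with repetitions.
\<close>

lemma extremal_vecsD: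
  assumes n: "1 \<le> n" and v: "v \<in> extremal_vecs n d" and A: "finite A" "f ` A \<subseteq> diagrams n d"
    and a: "\<And>x. x \<in> A \<Longrightarrow> (0::rat) \<le> a x" and eq: "\<And>i. v i = (\<Sum>x\<in>A. a x * diagram_vec n (f x) i)"
    and x: "x \<in> A" "0 < a x"
  shows "diagram_vec n (f x) = v"
proof -
  define c where "c b = (\<Sum>x\<in>{x \<in> A. f x = b}. a x)" for b
  have "\<forall>b. 0 \<le> c b" unfolding c_def using a by (auto intro!: sum_nonneg)
  moreover have "v = (\<lambda>i. \<Sum>b\<in>diagrams n d. c b * diagram_vec n b i)"
    unfolding c_def using eq sum_diagrams_regroup[OF n A, of a] by (intro ext) simp
  moreover have "0 < c (f x)" unfolding c_def using A a x by (intro sum_pos2[of _ x]) auto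
  moreover have "f x \<in> diagrams n d" using A x by auto
  ultimately show ?thesis using v unfolding extremal_vecs_def by blast
qed

lemma extremal_vecs_average:
  assumes n: "1 \<le> n" and v: "diagram_vec n b \<in> extremal_vecs n d"
    and b1: "b1 \<in> diagrams n d" and b2: "b2 \<in> diagrams n d"
    and eq: "\<And>i. diagram_vec n b1 i + diagram_vec n b2 i = 2 * diagram_vec n b i"
  shows "diagram_vec n b1 = diagram_vec n b"
proof -
  have "diagram_vec n (if True then b1 else b2) = diagram_vec n b"
    using b1 b2
  proof (intro extremal_vecsD[OF n v, of "UNIV :: bool set" "\<lambda>x. if x then b1 else b2" "\<lambda>_. 1 / 2" True])
    show "diagram_vec n b i = (\<Sum>x\<in>UNIV. 1 / 2 * diagram_vec n (if x then b1 else b2) i)" for i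
      using eq[of i] by (simp add: UNIV_bool)
  qed auto
  then show ?thesis by simp
qed

lemma extremal_vecs_0: "1 \<le> n \<Longrightarrow> v \<in> extremal_vecs n d \<Longrightarrow> v 0 = 1"
  by (auto simp: extremal_vecs_def diagram_vec_0)

lemma sum_coeffs_eq_1:
  assumes n: "1 \<le> n" and v: "v 0 = 1" and eq: "v = (\<lambda>i. \<Sum>b\<in>diagrams n d. c b * diagram_vec n b i)"
  shows "(\<Sum>b\<in>diagrams n d. c b) = 1"
proof -
  have "(\<Sum>b\<in>diagrams n d. c b) = (\<Sum>b\<in>diagrams n d. c b * diagram_vec n b 0)"
    by (intro sum.cong) (auto simp: diagram_vec_0[OF _ n])
  also have "\<dots> = v 0" using eq by simp
  finally show ?thesis using v by simp
qed

lemma sum_zero_summand: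
  assumes n: "1 \<le> n" and c: "\<forall>b. (0::rat) \<le> c b" and s: "(\<Sum>b\<in>diagrams n d. c b * g b) = 0"
    and g: "\<And>b. b \<in> diagrams n d \<Longrightarrow> 0 < c b \<Longrightarrow> 0 \<le> g b" and b: "b \<in> diagrams n d" "0 < c b"
  shows "g b = 0"
proof -
  have "c b * g b \<ge> 0" if "b \<in> diagrams n d" for b
    using c g[OF that] by (cases "c b = 0") (auto simp: less_le)
  then have "c b * g b = 0"
    using s b sum_nonneg_eq_0_iff[OF finite_diagrams[OF n], of d "\<lambda>b. c b * g b"] by auto
  then show ?thesis using b by simp
qed

lemma diagrams_pred:
  assumes n: "1 \<le> n" and b: "b \<in> diagrams n (Suc d)" and z: "diagram_vec n b (Suc d) = 0"
  shows "b \<in> diagrams n d"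
proof -
  have 1: "b j + n * j \<le> Suc d \<or> Suc d < n * j" for j
    using z[unfolded diagram_vec_eq_0_iff[OF n]] not_le by blast
  have 2: "b j + n * j \<le> Suc (Suc d)" if "0 < b j" for j using b that by (auto simp: diagrams_def)
  have "b j + n * j \<le> Suc d" if "0 < b j" for j using 1[of j] 2[OF that] that by linarith
  then show ?thesis using b by (auto simp: diagrams_def)
qed

lemma diagrams_Suc: "diagrams n d \<subseteq> diagrams n (Suc d)"
  by (auto simp: diagrams_def le_Suc_eq)

text \<open>
  The vectors vanishing in degree \<open>d + 1\<close> form a face of the cone, because all entries are
  nonnegative.  So \<open>Ex(d)\<close> is the part of \<open>Ex(d + 1)\<close> that vanishes in degree \<open>d + 1\<close>.
\<close>

lemma extremal_vecs_Suc_iff: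
  assumes n: "1 \<le> n"
  shows "v \<in> extremal_vecs n d \<longleftrightarrow> v \<in> extremal_vecs n (Suc d) \<and> v (Suc d) = 0"
proof (intro iffI conjI)
  assume v: "v \<in> extremal_vecs n d"
  then obtain b where b: "b \<in> diagrams n d" "v = diagram_vec n b" by (auto simp: extremal_vecs_def)
  show z: "v (Suc d) = 0" using diagram_vec_above[OF n b(1)] b(2) by simp
  show "v \<in> extremal_vecs n (Suc d)"
    unfolding extremal_vecs_def
  proof (intro CollectI conjI allI impI ballI)
    show "v \<in> diagram_vec n ` diagrams n (Suc d)" using b diagrams_Suc by auto
    fix c b' assume c: "\<forall>b. 0 \<le> c b" and eq: "v = (\<lambda>i. \<Sum>b\<in>diagrams n (Suc d). c b * diagram_vec n b i)"
      and b': "b' \<in> diagrams n (Suc d)" "0 < c b'"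
    let ?A = "{b \<in> diagrams n (Suc d). 0 < c b}"
    have sub: "?A \<subseteq> diagrams n d"
    proof
      fix b assume b: "b \<in> ?A"
      have "diagram_vec n b (Suc d) = 0"
        using z b unfolding eq by (intro sum_zero_summand[OF n c, where d = "Suc d" and g = "\<lambda>b. diagram_vec n b (Suc d)"]) (auto simp: diagram_vec_nonneg)
      then show "b \<in> diagrams n d" using b diagrams_pred[OF n] by auto
    qed
    have "v i = (\<Sum>b\<in>?A. c b * diagram_vec n b i)" for i
      unfolding eq using c finite_diagrams[OF n] by (intro sum.mono_neutral_right) (auto simp: less_le)
    from extremal_vecsD[OF n v, of ?A id c, simplified] this sub b' c finite_diagrams[OF n]
    show "diagram_vec n b' = v" by auto
  qed
next
  assume v: "v \<in> extremal_vecs n (Suc d) \<and> v (Suc d) = 0"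
  then obtain b where b: "b \<in> diagrams n (Suc d)" "v = diagram_vec n b" by (auto simp: extremal_vecs_def)
  show "v \<in> extremal_vecs n d"
    unfolding extremal_vecs_def
  proof (intro CollectI conjI allI impI ballI)
    show "v \<in> diagram_vec n ` diagrams n d" using b v diagrams_pred[OF n b(1)] by auto
    fix c b' assume c: "\<forall>b. 0 \<le> c b" and eq: "v = (\<lambda>i. \<Sum>b\<in>diagrams n d. c b * diagram_vec n b i)"
      and b': "b' \<in> diagrams n d" "0 < c b'"
    show "diagram_vec n b' = v"
      using extremal_vecsD[OF n conjunct1[OF v], of "diagrams n d" id c b', simplified] eq b' c
        finite_diagrams[OF n] diagrams_Suc by auto
  qed
qed

text \<open>
  A convex combination of vectors that are all at most \<open>s^d\<close> can equal \<open>s^d\<close> only if each of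
  them does.
\<close>

lemma s_vec_extremal:
  assumes n: "1 \<le> n"
  shows "s_vec n d \<in> extremal_vecs n d"
  unfolding extremal_vecs_def
proof (intro CollectI conjI allI impI ballI)
  have "(\<lambda>j. d + 1 - n * j) \<in> diagrams n d"
    by (auto simp: diagrams_def antimono_iff_le_Suc)
  moreover have "diagram_vec n (\<lambda>j. d + 1 - n * j) = s_vec n d" by (rule diagram_vec_triangle[OF n refl])
  ultimately show "s_vec n d \<in> diagram_vec n ` diagrams n d" by (metis imageI)
  fix c b assume c: "\<forall>b. 0 \<le> c b" and eq: "s_vec n d = (\<lambda>i. \<Sum>b\<in>diagrams n d. c b * diagram_vec n b i)"
    and b: "b \<in> diagrams n d" "0 < c b"
  have 1: "(\<Sum>b\<in>diagrams n d. c b) = 1" by (rule sum_coeffs_eq_1[OF n _ eq]) (simp add: s_vec_def)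
  show "diagram_vec n b = s_vec n d"
  proof
    fix i
    have "(\<Sum>b\<in>diagrams n d. c b * (s_vec n d i - diagram_vec n b i)) =
        (\<Sum>b\<in>diagrams n d. c b) * s_vec n d i - (\<Sum>b\<in>diagrams n d. c b * diagram_vec n b i)"
      by (simp add: algebra_simps sum_subtractf sum_distrib_left)
    also have "\<dots> = 0" using 1 fun_cong[OF eq, of i] by simp
    finally have "s_vec n d i - diagram_vec n b i = 0"
      using b diagram_vec_le_s_vec[OF n] by (intro sum_zero_summand[OF n c, where d = d and g = "\<lambda>b. s_vec n d i - diagram_vec n b i"]) auto
    then show "diagram_vec n b i = s_vec n d i" by simp
  qed
qed


section \<open>Towers over extremal diagrams\<close>

lemma diagram_vec_origin: "1 \<le> n \<Longrightarrow> diagram_vec n b 0 = of_bool (0 < b 0)"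
  using diagram_vec_sum[of n 0 0 b] by (auto simp: interval_ind_def)

lemma t_vec_at:
  assumes "1 \<le> n" "d = n * m + r" "r + 2 \<le> n" "1 \<le> m"
  shows "t_vec n d 0 = 1" "t_vec n d d = 1" "t_vec n d (n * m - 1) = 0"
proof -
  have dm: "d mod n = r" using assms by simp
  obtain m' where m': "m = Suc m'" using assms by (cases m) auto
  have "n * m - 1 = n * m' + (n - 1)" using assms m' by simp
  then have "(n * m - 1) mod n = (n - 1) mod n" by (simp only: mod_mult_self4)
  then have "(n * m - 1) mod n = n - 1" using assms by simp
  then show "t_vec n d (n * m - 1) = 0" using assms dm by (auto simp: t_vec_def)
qed (simp_all add: t_vec_def)

lemma t_star_inj: "t_star n d w = t_star n d w' \<Longrightarrow> w = w'"
proof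
  fix i assume "t_star n d w = t_star n d w'"
  from fun_cong[OF this, of "i + (d mod n + 1)"] show "w i = w' i" by (simp add: t_star_def)
qed

lemma t_star_0: "t_star n d (\<lambda>_. 0) = t_vec n d"
  by (auto simp: t_star_def)

definition lift_diagram :: "nat \<Rightarrow> nat \<Rightarrow> (nat \<Rightarrow> nat) \<Rightarrow> nat \<Rightarrow> nat" where
  "lift_diagram m r c j = (if j \<le> m then c j + (r + 1) else 0)"

text \<open>
  This inverts the removal of the first \<open>r + 1\<close> columns.  The bound on \<open>c\<close> keeps the shifted
  monomials below degree \<open>n m - 1\<close>; it allows \<open>c\<close> to be empty, which gives \<open>t^d\<close> itself.
\<close>

lemma lift_diagram:
  assumes n: "1 \<le> n" and d: "d = n * m + r" and r: "r < n" and c: "antimono c"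
    and top: "\<And>j. 0 < c j \<Longrightarrow> c j + n * j \<le> n * m - r - 2"
  shows "lift_diagram m r c \<in> diagrams n d"
    and "diagram_vec n (lift_diagram m r c) = t_star n d (diagram_vec n c)"
proof -
  have cm: "c j = 0" if "m \<le> j" for j
  proof (rule ccontr)
    assume "c j \<noteq> 0"
    then have "c j + n * j \<le> n * m - r - 2" using top[of j] by simp
    moreover have "n * m \<le> n * j" using that by (rule mult_le_mono2)
    ultimately show False using \<open>c j \<noteq> 0\<close> by linarith
  qed
  have anti: "c (Suc j) \<le> c j" for j using c by (simp add: antimono_iff_le_Suc)
  have "c j + (r + 1) + n * j \<le> d + 1" if "j \<le> m" for j
  proof (cases "c j = 0")
    case True
    have "n * j \<le> n * m" using that by (rule mult_le_mono2)
    then show ?thesis using True d by linarith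
  next
    case False
    then show ?thesis using top[of j] d by linarith
  qed
  then show "lift_diagram m r c \<in> diagrams n d"
    using anti by (auto simp: diagrams_def lift_diagram_def antimono_iff_le_Suc)
  have "(\<lambda>j. lift_diagram m r c j - (r + 1)) = c"
    using cm by (auto simp: lift_diagram_def)
  then show "diagram_vec n (lift_diagram m r c) = t_star n d (diagram_vec n c)"
    using t_star_diagram[OF n d r, of "lift_diagram m r c"] by (simp add: lift_diagram_def)
qed

text \<open>
  A monomial \<open>x^a y^j\<close> with \<open>j < m\<close> and degree at least \<open>n m - 1\<close> has the divisor
  \<open>x^(n m - 1 - n j) y^j\<close> of degree \<open>n m - 1\<close>.  If the diagram has nothing in that degree, its only
  candidate in degree \<open>d\<close> is \<open>x^r y^m\<close>; once this is present, so is the rectangle below it, and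
  everything outside the rectangle has degree at most \<open>n m - 2\<close>.
\<close>

lemma tower_diagram:
  assumes n: "1 \<le> n" and d: "d = n * m + r" and r: "r < n" and m: "1 \<le> m"
    and b: "b \<in> diagrams n d" and gap: "diagram_vec n b (n * m - 1) = 0"
  shows "diagram_vec n b d \<le> 1"
    and "diagram_vec n b d \<noteq> 0 \<Longrightarrow> \<exists>c. antimono c \<and> (\<forall>j. 0 < c j \<longrightarrow> c j + n * j \<le> n * m - r - 2) \<and>
      diagram_vec n b = t_star n d (diagram_vec n c)"
proof -
  have bd: "0 < b j \<Longrightarrow> b j + n * j \<le> d + 1" for j using b by (auto simp: diagrams_def)
  have anti: "antimono b" using b by (simp add: diagrams_def)
  have nm: "n \<le> n * m" "1 \<le> n * m" using m n by auto
  have low: "b j + n * j \<le> n * m - 1" if "j < m" for j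
  proof -
    have "n * Suc j \<le> n * m" using that by (intro mult_le_mono2) simp
    then have "n * j \<le> n * m - 1" using n by simp
    then show ?thesis using gap[unfolded diagram_vec_eq_0_iff[OF n]] by blast
  qed
  have high: "b j = 0" if "m < j" for j
  proof (rule ccontr)
    assume "b j \<noteq> 0"
    moreover have "n * Suc m \<le> n * j" using that by (intro mult_le_mono2) simp
    ultimately show False using bd[of j] d r by simp
  qed
  have sub: "{j. n * j \<le> d \<and> d < b j + n * j} \<subseteq> {m}"
  proof
    fix j assume j: "j \<in> {j. n * j \<le> d \<and> d < b j + n * j}"
    have "\<not> j < m" using low[of j] j d by auto
    moreover have "\<not> m < j" using high[of j] j by auto
    ultimately show "j \<in> {m}" by simp
  qed
  show "diagram_vec n b d \<le> 1"
    using card_mono[OF _ sub] by (simp add: diagram_vec_def diagram_count_def)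
  assume "diagram_vec n b d \<noteq> 0"
  then obtain j where "n * j \<le> d" "d < b j + n * j"
    unfolding diagram_vec_eq_0_iff[OF n] not_all not_imp not_le by blast
  then have "d < b m + n * m" using sub by auto
  then have bm: "b m = r + 1" using bd[of m] d by auto
  define c where "c j = b j - (r + 1)" for j
  have le: "r + 1 \<le> b j" if "j \<le> m" for j using antimonoD[OF anti that] bm by simp
  have 1: "diagram_vec n b = t_star n d (diagram_vec n c)"
    using t_star_diagram[OF n d r le high] by (simp add: c_def[abs_def])
  have 2: "c j + n * j \<le> n * m - r - 2" if "0 < c j" for j
  proof -
    have "j < m" using that bm high[of j] by (cases j m rule: linorder_cases) (auto simp: c_def)
    then show ?thesis using low[of j] that by (simp add: c_def)
  qed
  have 3: "antimono c" using anti by (auto simp: c_def antimono_def diff_le_mono)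
  show "\<exists>c. antimono c \<and> (\<forall>j. 0 < c j \<longrightarrow> c j + n * j \<le> n * m - r - 2) \<and>
      diagram_vec n b = t_star n d (diagram_vec n c)" using 1 2 3 by blast
qed

lemma empty_or_diagram:
  assumes n: "1 \<le> n" and c: "antimono c" and top: "\<forall>j. 0 < c j \<longrightarrow> c j + n * j \<le> n * m - r - 2"
  shows "c 0 = 0 \<and> diagram_vec n c = (\<lambda>_. 0) \<or> r + 3 \<le> n * m \<and> c \<in> diagrams n (n * m - r - 3)"
proof (cases "c 0 = 0")
  case True
  then have "c j = 0" for j using antimonoD[OF c, of 0 j] by simp
  then have "c = (\<lambda>_. 0)" by (rule ext)
  then have "diagram_vec n c = (\<lambda>_. 0)" using diagram_vec_empty[OF n] by simp
  then show ?thesis using True by blast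
next
  case False
  then have 1: "r + 3 \<le> n * m" using False spec[OF top, of 0] by simp
  then have "n * m - r - 2 = n * m - r - 3 + 1" by simp
  then have "c \<in> diagrams n (n * m - r - 3)" using c top False by (auto simp: diagrams_def)
  then show ?thesis using 1 by blast
qed

lemma t_star_extremal:
  assumes n: "1 \<le> n" and d: "d = n * m + r" and r: "r + 2 \<le> n" and m: "1 \<le> m"
    and w: "w = (\<lambda>_. 0) \<or> r + 3 \<le> n * m \<and> w \<in> extremal_vecs n (n * m - r - 3)"
  shows "t_star n d w \<in> extremal_vecs n d"
  unfolding extremal_vecs_def
proof (intro CollectI conjI allI impI ballI)
  have r': "r < n" using r by simp
  have dm: "d mod n = r" using d r' by simp
  obtain c where c: "antimono c" "\<forall>j. 0 < c j \<longrightarrow> c j + n * j \<le> n * m - r - 2" "w = diagram_vec n c"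
  proof -
    from w consider "w = (\<lambda>_. 0)" | b where "r + 3 \<le> n * m" "b \<in> diagrams n (n * m - r - 3)" "w = diagram_vec n b"
      unfolding extremal_vecs_def by blast
    then show ?thesis
    proof cases
      case 1
      have "diagram_vec n (\<lambda>_. 0) = w" using 1 diagram_vec_empty[OF n] by simp
      then show ?thesis using that[of "\<lambda>_. 0"] by (simp add: antimono_def)
    next
      case 2
      have "n * m - r - 3 + 1 = n * m - r - 2" using 2(1) by simp
      with 2(2) have "antimono b \<and> (\<forall>j. 0 < b j \<longrightarrow> b j + n * j \<le> n * m - r - 2)"
        unfolding diagrams_def mem_Collect_eq by metis
      then show ?thesis using that[of b] 2(3) by blast
    qed
  qed
  show "t_star n d w \<in> diagram_vec n ` diagrams n d"
    using lift_diagram[OF n d r' c(1)] c(2,3) by (metis imageI)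
  have wz: "w i = 0" if "n * m - r - 2 \<le> i" for i
  proof -
    have "c j + n * j \<le> i" if "n * j \<le> i" for j
      using c(2) \<open>n * m - r - 2 \<le> i\<close> that by (cases "c j = 0") (auto intro: order_trans)
    then show ?thesis unfolding c(3) by (simp add: diagram_vec_eq_0_iff[OF n])
  qed
  fix a b assume a: "\<forall>b. 0 \<le> a b" and eq: "t_star n d w = (\<lambda>i. \<Sum>b\<in>diagrams n d. a b * diagram_vec n b i)"
    and b: "b \<in> diagrams n d" "0 < a b"
  note t = t_vec_at[OF n d r m]
  have nm: "n \<le> n * m" using m by simp
  have v0: "t_star n d w 0 = 1" using t by (simp add: t_star_def)
  have vg: "t_star n d w (n * m - 1) = 0" using t nm r wz[of "n * m - 1 - (r + 1)"] by (simp add: t_star_def dm)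
  have vd: "t_star n d w d = 1" using t nm r wz[of "d - (r + 1)"] d by (simp add: t_star_def dm)
  have s1: "(\<Sum>b\<in>diagrams n d. a b) = 1" by (rule sum_coeffs_eq_1[OF n v0 eq])
  \<comment> \<open>The entries \<open>0\<close> in degree \<open>n m - 1\<close> and \<open>1\<close> in degree \<open>d\<close> are extreme values, so each summand attains them.\<close>
  have gap: "diagram_vec n b (n * m - 1) = 0" if "b \<in> diagrams n d" "0 < a b" for b
    using that vg unfolding eq
    by (intro sum_zero_summand[OF n a, where d = d and g = "\<lambda>b. diagram_vec n b (n * m - 1)"]) (auto simp: diagram_vec_nonneg)
  have one: "1 - diagram_vec n b d = 0" if "b \<in> diagrams n d" "0 < a b" for b
  proof (rule sum_zero_summand[OF n a _ _ that, where g = "\<lambda>b. 1 - diagram_vec n b d"])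
    show "(\<Sum>b\<in>diagrams n d. a b * (1 - diagram_vec n b d)) = 0"
      using s1 fun_cong[OF eq, of d] vd by (simp add: algebra_simps sum_subtractf)
    show "0 \<le> 1 - diagram_vec n b d" if "b \<in> diagrams n d" "0 < a b" for b
      using tower_diagram(1)[OF n d r' m that(1) gap[OF that]] by simp
  qed
  let ?A = "{b \<in> diagrams n d. 0 < a b}"
  have "\<forall>b\<in>?A. \<exists>c. antimono c \<and> (\<forall>j. 0 < c j \<longrightarrow> c j + n * j \<le> n * m - r - 2) \<and>
      diagram_vec n b = t_star n d (diagram_vec n c)"
  proof
    fix b assume "b \<in> ?A"
    then have ab: "b \<in> diagrams n d" "0 < a b" by auto
    have "diagram_vec n b d \<noteq> 0" using one[OF ab] by simp
    from tower_diagram(2)[OF n d r' m ab(1) gap[OF ab] this]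
    show "\<exists>c. antimono c \<and> (\<forall>j. 0 < c j \<longrightarrow> c j + n * j \<le> n * m - r - 2) \<and>
      diagram_vec n b = t_star n d (diagram_vec n c)" .
  qed
  from bchoice[OF this] obtain C where C: "\<And>b. b \<in> ?A \<Longrightarrow> antimono (C b)"
    "\<And>b. b \<in> ?A \<Longrightarrow> \<forall>j. 0 < C b j \<longrightarrow> C b j + n * j \<le> n * m - r - 2"
    "\<And>b. b \<in> ?A \<Longrightarrow> diagram_vec n b = t_star n d (diagram_vec n (C b))" by blast
  have fA: "finite ?A" using finite_diagrams[OF n] by simp
  have sA: "(\<Sum>b\<in>diagrams n d. a b * g b) = (\<Sum>b\<in>?A. a b * g b)" for g
    using a finite_diagrams[OF n] by (intro sum.mono_neutral_right) (auto simp: less_le)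
  have weq: "w i = (\<Sum>b\<in>?A. a b * diagram_vec n (C b) i)" for i
  proof -
    let ?i = "i + (r + 1)"
    have "w i = t_star n d w ?i - t_vec n d ?i" by (simp add: t_star_def dm)
    also have "t_star n d w ?i = (\<Sum>b\<in>?A. a b * diagram_vec n b ?i)"
      using fun_cong[OF eq, of ?i] sA by simp
    also have "\<dots> = (\<Sum>b\<in>?A. a b * (t_vec n d ?i + diagram_vec n (C b) i))"
      by (intro sum.cong) (auto simp: C(3) t_star_def dm)
    also have "\<dots> = (\<Sum>b\<in>?A. a b) * t_vec n d ?i + (\<Sum>b\<in>?A. a b * diagram_vec n (C b) i)"
      by (simp add: algebra_simps sum.distrib sum_distrib_left)
    also have "(\<Sum>b\<in>?A. a b) = 1" using s1 sA[of "\<lambda>_. 1"] by simp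
    finally show ?thesis by simp
  qed
  have "diagram_vec n (C b) = w"
    using w
  proof
    assume w0: "w = (\<lambda>_. 0)"
    show ?thesis
    proof
      fix i
      have "a b * diagram_vec n (C b) i = 0"
        using weq[of i] w0 sum_nonneg_eq_0_iff[OF fA, of "\<lambda>b. a b * diagram_vec n (C b) i"] b a
        by (auto simp: diagram_vec_nonneg)
      then show "diagram_vec n (C b) i = w i" using b w0 by simp
    qed
  next
    assume w: "r + 3 \<le> n * m \<and> w \<in> extremal_vecs n (n * m - r - 3)"
    have "C b \<in> diagrams n (n * m - r - 3)" if "b \<in> ?A" for b
    proof -
      have "0 < C b 0"
      proof (rule ccontr)
        assume "\<not> 0 < C b 0"
        have "(\<Sum>b\<in>?A. a b * (1 - diagram_vec n (C b) 0)) = 0"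
          using weq[of 0] extremal_vecs_0[OF n conjunct2[OF w]] s1 sA[of "\<lambda>_. 1"]
          by (simp add: algebra_simps sum_subtractf)
        then have "a b * (1 - diagram_vec n (C b) 0) = 0"
          using sum_nonneg_eq_0_iff[OF fA, of "\<lambda>b. a b * (1 - diagram_vec n (C b) 0)"] that a
          by (auto simp: diagram_vec_origin[OF n])
        then show False using that \<open>\<not> 0 < C b 0\<close> by (auto simp: diagram_vec_origin[OF n])
      qed
      then show ?thesis
        using empty_or_diagram[OF n C(1)[OF that] C(2)[OF that]] by auto
    qed
    then show ?thesis
      using b a by (intro extremal_vecsD[OF n conjunct2[OF w] fA _ _ weq]) auto
  qed
  then show "diagram_vec n b = t_star n d w" using C(3)[of b] b by simp
qed


section \<open>The recursion for extremal vectors\<close>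

text \<open>
  A combination representing \<open>h\<close> lifts, diagram by diagram, to one representing \<open>t^d * h\<close>: its
  coefficients add up to \<open>1\<close>, so that the copies of \<open>t^d\<close> add up to \<open>t^d\<close>.
\<close>

lemma t_star_extremal_imp_extremal:
  assumes n: "1 \<le> n" and d: "d = n * m + r" and r: "r < n" and le: "r + 3 \<le> n * m"
    and c: "c \<in> diagrams n (n * m - r - 3)" and v: "t_star n d (diagram_vec n c) \<in> extremal_vecs n d"
  shows "diagram_vec n c \<in> extremal_vecs n (n * m - r - 3)"
  unfolding extremal_vecs_def
proof (intro CollectI conjI allI impI ballI)
  let ?D = "diagrams n (n * m - r - 3)" and ?w = "diagram_vec n c"
  have dm: "d mod n = r" using d r by simp
  show "?w \<in> diagram_vec n ` ?D" using c by blast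
  fix a b assume a: "\<forall>b. 0 \<le> a b" and eq: "?w = (\<lambda>i. \<Sum>b\<in>?D. a b * diagram_vec n b i)"
    and b: "b \<in> ?D" "0 < a b"
  have lift: "lift_diagram m r b \<in> diagrams n d"
      "diagram_vec n (lift_diagram m r b) = t_star n d (diagram_vec n b)" if "b \<in> ?D" for b
  proof -
    have "n * m - r - 3 + 1 = n * m - r - 2" using le by simp
    with that have "antimono b" "0 < b j \<Longrightarrow> b j + n * j \<le> n * m - r - 2" for j
      unfolding diagrams_def mem_Collect_eq by metis+
    from lift_diagram[OF n d r this] show "lift_diagram m r b \<in> diagrams n d"
      "diagram_vec n (lift_diagram m r b) = t_star n d (diagram_vec n b)" by auto
  qed
  have s1: "(\<Sum>b\<in>?D. a b) = 1" by (rule sum_coeffs_eq_1[OF n diagram_vec_0[OF c n] eq])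
  have "diagram_vec n (lift_diagram m r b) = t_star n d ?w"
  proof (rule extremal_vecsD[OF n v finite_diagrams[OF n], where f = "lift_diagram m r" and a = a])
    show "lift_diagram m r ` ?D \<subseteq> diagrams n d" using lift by auto
    fix i
    have "(\<Sum>b\<in>?D. a b * diagram_vec n (lift_diagram m r b) i) =
      (\<Sum>b\<in>?D. a b * t_vec n d i + (if r + 1 \<le> i then a b * diagram_vec n b (i - (r + 1)) else 0))"
      by (intro sum.cong) (auto simp: lift(2) t_star_def dm algebra_simps)
    also have "\<dots> = (\<Sum>b\<in>?D. a b) * t_vec n d i + (if r + 1 \<le> i then ?w (i - (r + 1)) else 0)"
      unfolding sum.distrib sum_distrib_right[symmetric] by (subst eq) simp
    finally show "t_star n d ?w i = (\<Sum>b\<in>?D. a b * diagram_vec n (lift_diagram m r b) i)"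
      using s1 by (simp add: t_star_def dm)
  qed (use a b in auto)
  then show "diagram_vec n b = ?w" using lift(2)[OF b(1)] t_star_inj by metis
qed

text \<open>
  The classification of the extremal vectors of top degree exactly \<open>d\<close>.  Since the first
  move does not apply, the ends of the rows do not decrease, so the last row is row
  \<open>m = d div n\<close> and has length \<open>r + 1\<close>.  If all other rows have length at
  least \<open>n\<close>, the second move applies unless the first row reaches degree \<open>d\<close>, and then all
  rows do.  Otherwise row \<open>m - 1\<close> is shorter than \<open>n\<close>, no row
  contains a monomial of degree \<open>n m - 1\<close>, and the diagram is a tower.
\<close>

lemma extremal_vecs_top:
  assumes n: "1 \<le> n" and d: "d = n * m + r" and r: "r < n"
    and v: "v \<in> extremal_vecs n d" and vd: "v d \<noteq> 0"
  shows "v = s_vec n d \<or> r + 2 \<le> n \<and> 1 \<le> m \<and> (v = t_vec n d \<or>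
    r + 3 \<le> n * m \<and> (\<exists>w\<in>extremal_vecs n (n * m - r - 3). v = t_star n d w))"
proof -
  obtain b where b: "b \<in> diagrams n d" and vb: "v = diagram_vec n b"
    using v unfolding extremal_vecs_def by blast
  have anti: "antimono b" and bd: "\<And>j. 0 < b j \<Longrightarrow> b j + n * j \<le> d + 1" using b by (auto simp: diagrams_def)
  have slow: "b j \<le> b (Suc j) + n" for j
  proof (rule ccontr)
    assume "\<not> b j \<le> b (Suc j) + n"
    then have steep: "b (Suc j) + n < b j" by simp
    from steep_step_diagrams[OF n b steep] extremal_vecs_average[OF n v[unfolded vb], OF _ _ steep_step_average[OF n steep]]
    show False by blast
  qed
  have mono: "b j + n * j \<le> b k + n * k" if "j \<le> k" for j k
    using that
  proof (induction k rule: dec_induct)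
    case (step k)
    then show ?case using slow[of k] by simp
  qed simp
  have zero: "b k = 0" if "m < k" for k
  proof (rule ccontr)
    assume "b k \<noteq> 0"
    moreover have "n * Suc m \<le> n * k" using that by (intro mult_le_mono2) simp
    ultimately show False using bd[of k] d r by simp
  qed
  obtain j where j: "n * j \<le> d" "d < b j + n * j"
    using vd unfolding vb diagram_vec_eq_0_iff[OF n] not_all not_imp not_le by blast
  have "j \<le> m" using j zero[of j] by (cases "m < j") auto
  then have "d + 1 \<le> b m + n * m" using mono[of j m] j by simp
  then have bm: "b m + n * m = d + 1" using bd[of m] d r by (cases "b m = 0") auto
  then have bmr: "b m = r + 1" using d by simp
  have bmn: "b m \<le> n" using slow[of m] zero[of "Suc m"] by simp
  show ?thesis
  proof (cases "\<forall>k<m. n \<le> b k")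
    case True
    then have wide: "\<And>k. k < m \<Longrightarrow> n \<le> b k" by blast
    have "\<not> b 0 < d + 1"
      using triangle_step_diagrams[OF n b zero bm wide _ bmn]
        extremal_vecs_average[OF n v[unfolded vb], OF _ _ triangle_step_average[where b = b, OF n zero bmn wide]]
      by blast
    then have ge: "d + 1 \<le> b k + n * k" for k using mono[of 0 k] by simp
    have "b k = d + 1 - n * k" for k
      using bd[of k] ge[of k] by (cases "b k = 0") linarith+
    then show ?thesis using diagram_vec_triangle[OF n] vb by blast
  next
    case False
    then obtain k where k: "k < m" "b k < n" by (auto simp: not_le)
    then have m: "1 \<le> m" by simp
    have rn: "r + 2 \<le> n" using antimonoD[OF anti, of k m] k bmr by simp
    have low: "b j + n * j \<le> n * m - 1" if "j < m" for j
    proof -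
      have m': "n * m = n * (m - 1) + n" using m by (cases m) auto
      have "b (m - 1) \<le> b k" using k by (intro antimonoD[OF anti]) simp
      then show ?thesis using mono[of j "m - 1"] that k m' by linarith
    qed
    have gap: "diagram_vec n b (n * m - 1) = 0"
      unfolding diagram_vec_eq_0_iff[OF n]
    proof (intro allI impI)
      fix j assume j: "n * j \<le> n * m - 1"
      have "1 \<le> n * m" using n m by simp
      then have "n * j < n * m" using j by linarith
      then show "b j + n * j \<le> n * m - 1" by (intro low) simp
    qed
    from tower_diagram(2)[OF n d r m b gap] vd vb
    obtain c where c: "antimono c" "\<forall>j. 0 < c j \<longrightarrow> c j + n * j \<le> n * m - r - 2" "v = t_star n d (diagram_vec n c)"
      by metis
    from empty_or_diagram[OF n c(1,2)] show ?thesis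
    proof (elim disjE conjE)
      assume "diagram_vec n c = (\<lambda>_. 0)"
      then show ?thesis using c(3) m rn by (simp add: t_star_0)
    next
      assume "r + 3 \<le> n * m" "c \<in> diagrams n (n * m - r - 3)"
      then show ?thesis
        using t_star_extremal_imp_extremal[OF n d r] v c(3) m rn by blast
    qed
  qed
qed

text \<open>
  Indexed by integers like \<open>Ex_points\<close>, with which it agrees by \<open>Ex_points_eq_extremal_upto\<close>.
\<close>

definition extremal_upto :: "nat \<Rightarrow> int \<Rightarrow> (nat \<Rightarrow> rat) set" where
  "extremal_upto n e = (if e < 0 then {} else extremal_vecs n (nat e))"

lemma extremal_upto_pred:
  assumes n: "1 \<le> n"
  shows "extremal_upto n (int d - 1) = {v \<in> extremal_vecs n d. v d = 0}"
proof (cases d)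
  case 0
  have "v 0 \<noteq> 0" if "v \<in> extremal_vecs n 0" for v using extremal_vecs_0[OF n that] by simp
  then show ?thesis using 0 by (auto simp: extremal_upto_def)
next
  case (Suc e)
  then show ?thesis using extremal_vecs_Suc_iff[OF n, of _ e] by (auto simp: extremal_upto_def)
qed

lemma extremal_upto_partial_row:
  assumes n: "1 \<le> n" and d: "d = n * m + r" and r: "r + 2 \<le> n"
  shows "extremal_upto n (int d) = extremal_upto n (int d - 1) \<union> {s_vec n d} \<union> {t_vec n d} \<union>
    {t_star n d h | h. h \<in> extremal_upto n (int d - 2 * int r - 3)}"
proof -
  have r': "r < n" using r by simp
  have e: "int d - 2 * int r - 3 = int (n * m) - int r - 3" using d by simp
  have E: "h \<in> extremal_upto n (int d - 2 * int r - 3) \<longleftrightarrow> r + 3 \<le> n * m \<and> h \<in> extremal_vecs n (n * m - r - 3)" for h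
  proof (cases "r + 3 \<le> n * m")
    case True
    define q where "q = n * m - r - 3"
    have "int (n * m) - int r - 3 = int q" using True by (simp add: q_def)
    then have "int d - 2 * int r - 3 = int q" using e by simp
    then show ?thesis unfolding extremal_upto_def q_def[symmetric] using True by simp
  next
    case False
    then have "int (n * m) - int r - 3 < 0" by linarith
    then show ?thesis unfolding e extremal_upto_def using False by simp
  qed
  have "t_vec n d \<in> extremal_vecs n d"
  proof (cases m)
    case 0
    have "t_vec n d = s_vec n d" using 0 d r' by (auto simp: t_vec_def s_vec_def)
    then show ?thesis using s_vec_extremal[OF n] by simp
  next
    case (Suc m')
    then show ?thesis using t_star_extremal[OF n d r, of "\<lambda>_. 0"] by (simp add: t_star_0)
  qed
  moreover have "t_star n d h \<in> extremal_vecs n d" if "r + 3 \<le> n * m" "h \<in> extremal_vecs n (n * m - r - 3)" for h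
    using that by (intro t_star_extremal[OF n d r]) (cases m, auto)
  moreover have "v \<in> {s_vec n d} \<union> {t_vec n d} \<union> {t_star n d h | h. r + 3 \<le> n * m \<and> h \<in> extremal_vecs n (n * m - r - 3)}"
    if "v \<in> extremal_vecs n d" "v d \<noteq> 0" for v
    using extremal_vecs_top[OF n d r' that] by blast
  ultimately show ?thesis
    unfolding E extremal_upto_pred[OF n] using s_vec_extremal[OF n, of d] by (auto simp: extremal_upto_def)
qed

lemma extremal_upto_full_row:
  assumes n: "1 \<le> n" and d: "d = n * m + r" and r: "r = n - 1"
  shows "extremal_upto n (int d) = extremal_upto n (int d - 1) \<union> {s_vec n d}"
proof -
  have "r < n" "\<not> r + 2 \<le> n" using n r by auto
  then show ?thesis
    unfolding extremal_upto_pred[OF n] using s_vec_extremal[OF n, of d] extremal_vecs_top[OF n d]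
    by (auto simp: extremal_upto_def)
qed

lemma extremal_upto_first_row:
  assumes n: "1 \<le> n" and d: "d \<le> n - 1"
  shows "extremal_upto n (int d) = {ones_vec l | l. 1 \<le> l \<and> l \<le> d + 1}"
  using d
proof (induction d)
  have step: "extremal_upto n (int d) = extremal_upto n (int d - 1) \<union> {ones_vec (d + 1)}" if "d \<le> n - 1" for d
  proof (cases "d + 2 \<le> n")
    case True
    have "s_vec n d = ones_vec (d + 1)" "t_vec n d = ones_vec (d + 1)"
      using True by (auto simp: s_vec_def t_vec_def ones_vec_def)
    moreover have "extremal_upto n (int d - 2 * int d - 3) = {}" by (simp add: extremal_upto_def)
    ultimately show ?thesis using extremal_upto_partial_row[OF n, of d 0 d] True by simp
  next
    case False
    then have "d = n - 1" using that by simp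
    moreover have "s_vec n d = ones_vec (d + 1)"
    proof
      fix i
      show "s_vec n d i = ones_vec (d + 1) i"
        using \<open>d = n - 1\<close> n by (cases "i < n") (auto simp: s_vec_def ones_vec_def)
    qed
    ultimately show ?thesis using extremal_upto_full_row[OF n, of d 0 d] by simp
  qed
  {
    case 0
    have "{ones_vec l | l. 1 \<le> l \<and> l \<le> 0 + 1} = {ones_vec 1}" by (auto simp: le_antisym)
    then show ?case using step[of 0] by (simp add: extremal_upto_def)
  next
    case (Suc d)
    have "{ones_vec l | l. 1 \<le> l \<and> l \<le> Suc d + 1} = {ones_vec l | l. 1 \<le> l \<and> l \<le> d + 1} \<union> {ones_vec (Suc d + 1)}"
      by (auto simp: le_Suc_eq)
    then show ?case using Suc step[of "Suc d"] by simp
  }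
qed

section \<open>Extremal rays of the cone of diagrams\<close>

lemma diagram_coneI:
  assumes "1 \<le> n" "b \<in> diagrams n d" "0 \<le> t"
  shows "(\<lambda>i. t * diagram_vec n b i) \<in> diagram_cone n d"
proof -
  have "(\<Sum>b'\<in>diagrams n d. (if b' = b then t else 0) * diagram_vec n b' i) = t * diagram_vec n b i" for i
    using finite_diagrams[OF assms(1), of d] assms(2) by (simp add: if_distrib[of "\<lambda>x. x * _"] sum.delta cong: if_cong)
  then show ?thesis
    unfolding diagram_cone_def using assms(3)
    by (intro CollectI exI[of _ "\<lambda>b'. if b' = b then t else 0"]) auto
qed

lemma diagram_cone_zero: "(\<lambda>_. 0) \<in> diagram_cone n d"
  unfolding diagram_cone_def by (intro CollectI exI[of _ "\<lambda>_. 0"]) auto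

lemma diagram_cone_add:
  assumes "v \<in> diagram_cone n d" "w \<in> diagram_cone n d"
  shows "(\<lambda>i. v i + w i) \<in> diagram_cone n d"
proof -
  obtain a b where "\<forall>x. 0 \<le> a x" "v = (\<lambda>i. \<Sum>x\<in>diagrams n d. a x * diagram_vec n x i)"
    "\<forall>x. 0 \<le> b x" "w = (\<lambda>i. \<Sum>x\<in>diagrams n d. b x * diagram_vec n x i)"
    using assms unfolding diagram_cone_def by blast
  then show ?thesis
    unfolding diagram_cone_def
    by (intro CollectI exI[of _ "\<lambda>x. a x + b x"]) (auto simp: algebra_simps sum.distrib)
qed

lemma diagram_cone_scale:
  assumes "v \<in> diagram_cone n d" "0 \<le> t"
  shows "(\<lambda>i. t * v i) \<in> diagram_cone n d"
proof -
  obtain a where "\<forall>x. 0 \<le> a x" "v = (\<lambda>i. \<Sum>x\<in>diagrams n d. a x * diagram_vec n x i)"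
    using assms unfolding diagram_cone_def by blast
  then show ?thesis
    unfolding diagram_cone_def using assms(2)
    by (intro CollectI exI[of _ "\<lambda>x. t * a x"]) (auto simp: algebra_simps sum_distrib_left)
qed

lemma diagram_cone_sum:
  assumes "finite A" "\<And>x. x \<in> A \<Longrightarrow> f x \<in> diagram_cone n d"
  shows "(\<lambda>i. \<Sum>x\<in>A. f x i) \<in> diagram_cone n d"
  using assms
proof (induction A rule: finite_induct)
  case (insert x A)
  then show ?case using diagram_cone_add[of "f x" n d "\<lambda>i. \<Sum>x\<in>A. f x i"] by simp
qed (simp add: diagram_cone_zero)

lemma diagram_vec_nonzero: "1 \<le> n \<Longrightarrow> b \<in> diagrams n d \<Longrightarrow> diagram_vec n b \<noteq> (\<lambda>_. 0)"
  using diagram_vec_0[of b n d] by auto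

lemma diagram_vec_Ints: "diagram_vec n b i \<in> \<int>"
  by (simp add: diagram_vec_def)

text \<open>
  An extremal ray contains every summand of its elements, hence is spanned by any diagram vector
  that occurs in one of them.
\<close>

lemma extremal_ray_diagram:
  assumes n: "1 \<le> n" and ray: "extremal_ray (diagram_cone n d) \<rho>"
    and c: "\<forall>b. 0 \<le> c b" and mem: "(\<lambda>i. \<Sum>b\<in>diagrams n d. c b * diagram_vec n b i) \<in> \<rho>"
    and b: "b \<in> diagrams n d" "0 < c b"
  shows "\<rho> = {\<lambda>i. t * diagram_vec n b i | t. 0 \<le> t}"
proof -
  let ?D = "diagrams n d"
  obtain v where v: "\<rho> = {\<lambda>i. t * v i | t. 0 \<le> t}"
    and face: "\<And>x y. x \<in> diagram_cone n d \<Longrightarrow> y \<in> diagram_cone n d \<Longrightarrow> (\<lambda>i. x i + y i) \<in> \<rho> \<Longrightarrow> x \<in> \<rho>"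
    using ray unfolding extremal_ray_def by blast
  let ?x = "\<lambda>i. c b * diagram_vec n b i" and ?y = "\<lambda>i. \<Sum>b'\<in>?D. (c(b := 0)) b' * diagram_vec n b' i"
  have split: "(\<lambda>i. \<Sum>b\<in>?D. c b * diagram_vec n b i) = (\<lambda>i. ?x i + ?y i)"
  proof
    fix i
    have "(\<Sum>b'\<in>?D - {b}. (c(b := 0)) b' * diagram_vec n b' i) = (\<Sum>b'\<in>?D - {b}. c b' * diagram_vec n b' i)"
      by (intro sum.cong) auto
    then show "(\<Sum>b\<in>?D. c b * diagram_vec n b i) = ?x i + ?y i"
      using sum.remove[OF finite_diagrams[OF n] b(1), of "\<lambda>b. c b * diagram_vec n b i"]
        sum.remove[OF finite_diagrams[OF n] b(1), of "\<lambda>b'. (c(b := 0)) b' * diagram_vec n b' i"] by simp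
  qed
  have "?x \<in> \<rho>"
  proof (rule face)
    show "?x \<in> diagram_cone n d" using b c by (intro diagram_coneI[OF n]) auto
    show "?y \<in> diagram_cone n d" unfolding diagram_cone_def using c by (intro CollectI exI[of _ "c(b := 0)"]) auto
    show "(\<lambda>i. ?x i + ?y i) \<in> \<rho>" using mem unfolding split .
  qed
  then obtain s where s: "0 \<le> s" "\<And>i. c b * diagram_vec n b i = s * v i" unfolding v by (auto simp: fun_eq_iff)
  have "c b = s * v 0" using s(2)[of 0] diagram_vec_0[OF b(1) n] by simp
  then have "0 < s" using b(2) s(1) by (cases "s = 0") auto
  have veq: "v i = (c b / s) * diagram_vec n b i" for i using s(2)[of i] \<open>0 < s\<close> by (simp add: field_simps)
  have pos: "0 < c b / s" using b(2) \<open>0 < s\<close> by simp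
  show ?thesis
    unfolding v
  proof (intro equalityI subsetI; clarify)
    fix t :: rat assume "0 \<le> t"
    then show "\<exists>t'. (\<lambda>i. t * v i) = (\<lambda>i. t' * diagram_vec n b i) \<and> 0 \<le> t'"
      using pos mult_nonneg_nonneg[OF \<open>0 \<le> t\<close> less_imp_le[OF pos]]
      by (intro exI[of _ "t * (c b / s)"]) (auto simp: veq fun_eq_iff)
  next
    fix t :: rat assume "0 \<le> t"
    then show "\<exists>t'. (\<lambda>i. t * diagram_vec n b i) = (\<lambda>i. t' * v i) \<and> 0 \<le> t'"
      using pos \<open>0 < s\<close> b(2) by (intro exI[of _ "t / (c b / s)"]) (auto simp: veq fun_eq_iff field_simps)
  qed
qed

text \<open>
  The entry \<open>1\<close> in degree \<open>0\<close> makes a diagram vector primitive.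
\<close>

lemma first_integer_point_diagram:
  assumes n: "1 \<le> n" and b: "b \<in> diagrams n d" and \<rho>: "\<rho> = {\<lambda>i. t * diagram_vec n b i | t. 0 \<le> t}"
  shows "first_integer_point \<rho> v \<longleftrightarrow> v = diagram_vec n b"
proof -
  have one: "diagram_vec n b 0 = 1" by (rule diagram_vec_0[OF b n])
  have mem: "diagram_vec n b \<in> integer_points \<rho>"
    unfolding integer_points_def \<rho> using diagram_vec_nonzero[OF n b] diagram_vec_Ints
    by (auto intro!: exI[of _ 1])
  have ge: "\<exists>t\<ge>1. w = (\<lambda>i. t * diagram_vec n b i)" if "w \<in> integer_points \<rho>" for w
  proof -
    have w: "w \<in> \<rho>" "w \<noteq> (\<lambda>_. 0)" "w 0 \<in> \<int>" using that by (simp_all add: integer_points_def)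
    obtain t where t: "0 \<le> t" "w = (\<lambda>i. t * diagram_vec n b i)" using w(1) unfolding \<rho> by auto
    have "t \<in> \<int>" using w(3) t(2) one by simp
    moreover have "t \<noteq> 0" using t(2) w(2) by auto
    ultimately have "1 \<le> t" using t(1) Ints_nonzero_abs_ge1[of t] by simp
    then show ?thesis using t(2) by blast
  qed
  show ?thesis
  proof
    assume v: "first_integer_point \<rho> v"
    then have "v \<in> integer_points \<rho>" by (simp add: first_integer_point_def)
    from ge[OF this] obtain t where t: "1 \<le> t" "v = (\<lambda>i. t * diagram_vec n b i)" by blast
    obtain s where s: "1 \<le> s" "diagram_vec n b = (\<lambda>i. s * v i)"
      using v mem unfolding first_integer_point_def by blast
    have "1 = s * t" using fun_cong[OF s(2), of 0] t(2) one by simp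
    moreover have "1 * t \<le> s * t" using s t by (intro mult_right_mono) auto
    ultimately have "t = 1" using t(1) by simp
    then show "v = diagram_vec n b" using t(2) by simp
  next
    assume "v = diagram_vec n b"
    then show "first_integer_point \<rho> v" using mem ge unfolding first_integer_point_def by blast
  qed
qed

lemma extremal_rays_diagram_cone:
  assumes n: "1 \<le> n"
  shows "{v. \<exists>\<rho>. extremal_ray (diagram_cone n d) \<rho> \<and> first_integer_point \<rho> v} = extremal_vecs n d"
proof (intro equalityI subsetI)
  let ?D = "diagrams n d"
  fix v assume "v \<in> {v. \<exists>\<rho>. extremal_ray (diagram_cone n d) \<rho> \<and> first_integer_point \<rho> v}"
  then obtain \<rho> where ray: "extremal_ray (diagram_cone n d) \<rho>" and first: "first_integer_point \<rho> v" by blast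
  obtain x where x: "x \<in> diagram_cone n d" "x \<noteq> (\<lambda>_. 0)" "\<rho> = {\<lambda>i. t * x i | t. 0 \<le> t}"
    using ray unfolding extremal_ray_def by blast
  then obtain c where c: "\<forall>b. 0 \<le> c b" "x = (\<lambda>i. \<Sum>b\<in>?D. c b * diagram_vec n b i)"
    unfolding diagram_cone_def by blast
  obtain b where b: "b \<in> ?D" "0 < c b"
  proof -
    have "\<exists>b\<in>?D. c b \<noteq> 0" using x(2) unfolding c(2) by (rule contrapos_np) simp
    then show ?thesis using that c(1) by (auto simp: less_le)
  qed
  have "x \<in> \<rho>" unfolding x(3) by (auto intro!: exI[of _ 1])
  then have \<rho>: "\<rho> = {\<lambda>i. t * diagram_vec n b i | t. 0 \<le> t}"
    unfolding c(2) by (intro extremal_ray_diagram[OF n ray c(1) _ b])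
  have v: "v = diagram_vec n b" using first first_integer_point_diagram[OF n b(1) \<rho>] by simp
  have "v \<in> \<rho>" using first by (simp add: first_integer_point_def integer_points_def)
  show "v \<in> extremal_vecs n d"
    unfolding extremal_vecs_def
  proof (intro CollectI conjI allI impI ballI)
    show "v \<in> diagram_vec n ` ?D" using v b by blast
    fix a b' assume a: "\<forall>b. 0 \<le> a b" "v = (\<lambda>i. \<Sum>b\<in>?D. a b * diagram_vec n b i)" and b': "b' \<in> ?D" "0 < a b'"
    from \<open>v \<in> \<rho>\<close> have "\<rho> = {\<lambda>i. t * diagram_vec n b' i | t. 0 \<le> t}"
      unfolding a(2) by (intro extremal_ray_diagram[OF n ray a(1) _ b'])
    from first_integer_point_diagram[OF n b'(1) this] first show "diagram_vec n b' = v" by simp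
  qed
next
  let ?D = "diagrams n d"
  fix v assume v: "v \<in> extremal_vecs n d"
  then obtain b where b: "b \<in> ?D" "v = diagram_vec n b" unfolding extremal_vecs_def by blast
  define \<rho> where "\<rho> = {\<lambda>i. t * v i | t. 0 \<le> t}"
  have side: "x \<in> \<rho>" if x: "x \<in> diagram_cone n d" and y: "y \<in> diagram_cone n d"
    and xy: "(\<lambda>i. x i + y i) \<in> \<rho>" for x y
  proof -
    obtain a where a: "\<forall>b. 0 \<le> a b" "x = (\<lambda>i. \<Sum>b\<in>?D. a b * diagram_vec n b i)"
      using x unfolding diagram_cone_def by blast
    obtain a' where a': "\<forall>b. 0 \<le> a' b" "y = (\<lambda>i. \<Sum>b\<in>?D. a' b * diagram_vec n b i)"
      using y unfolding diagram_cone_def by blast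
    obtain t where t: "0 \<le> t" "\<And>i. x i + y i = t * v i" using xy unfolding \<rho>_def by (auto simp: fun_eq_iff)
    have sum: "t * v i = (\<Sum>b\<in>?D. (a b + a' b) * diagram_vec n b i)" for i
      unfolding t(2)[symmetric] a(2) a'(2) by (simp add: algebra_simps sum.distrib)
    have "diagram_vec n b = v" if b: "b \<in> ?D" "0 < a b" for b
    proof (cases "t = 0")
      case True
      have "0 < (\<Sum>b\<in>?D. (a b + a' b) * diagram_vec n b 0)"
      proof (rule sum_pos2[OF finite_diagrams[OF n] b(1)])
        show "0 < (a b + a' b) * diagram_vec n b 0"
          using b a'(1) diagram_vec_0[OF b(1) n] by (simp add: add_pos_nonneg)
        show "0 \<le> (a b + a' b) * diagram_vec n b 0" for b using a(1) a'(1) by (simp add: diagram_vec_nonneg)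
      qed
      then show ?thesis using sum[of 0] True by simp
    next
      case False
      then have t': "0 < t" using t(1) by simp
      have "diagram_vec n (id b) = v"
      proof (rule extremal_vecsD[OF n v finite_diagrams[OF n] _ _ _ b(1)])
        show "id ` ?D \<subseteq> ?D" by simp
        show "0 \<le> (a b + a' b) / t" for b using a(1) a'(1) t' by simp
        show "v i = (\<Sum>b\<in>?D. (a b + a' b) / t * diagram_vec n (id b) i)" for i
        proof -
          have "(\<Sum>b\<in>?D. (a b + a' b) / t * diagram_vec n (id b) i) = (\<Sum>b\<in>?D. (a b + a' b) * diagram_vec n b i) / t"
            unfolding sum_divide_distrib by (intro sum.cong) auto
          then show ?thesis unfolding sum[symmetric] using t' by simp
        qed
        show "0 < (a b + a' b) / t" using b(2) a'(1) t' by (simp add: add_pos_nonneg)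
      qed
      then show ?thesis by simp
    qed
    then have "a b * diagram_vec n b i = a b * v i" if "b \<in> ?D" for b i
      using that a(1) by (cases "a b = 0") (auto simp: less_le)
    then have "x i = (\<Sum>b\<in>?D. a b) * v i" for i
      unfolding a(2) sum_distrib_right by (intro sum.cong) auto
    moreover have "0 \<le> (\<Sum>b\<in>?D. a b)" using a(1) by (simp add: sum_nonneg)
    ultimately show ?thesis unfolding \<rho>_def by blast
  qed
  have "v \<in> diagram_cone n d" using diagram_coneI[OF n b(1), of 1] b(2) by simp
  moreover have "v \<noteq> (\<lambda>_. 0)" using diagram_vec_nonzero[OF n b(1)] b(2) by simp
  moreover have "y \<in> \<rho>" if x: "x \<in> diagram_cone n d" and y: "y \<in> diagram_cone n d"
    and xy: "(\<lambda>i. x i + y i) \<in> \<rho>" for x y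
    using side[OF y x] xy by (simp add: add.commute)
  ultimately have "extremal_ray (diagram_cone n d) \<rho>"
    unfolding extremal_ray_def using side \<rho>_def by blast
  moreover have "first_integer_point \<rho> v"
    using first_integer_point_diagram[OF n b(1), of \<rho> v] b(2) \<rho>_def by simp
  ultimately show "v \<in> {v. \<exists>\<rho>. extremal_ray (diagram_cone n d) \<rho> \<and> first_integer_point \<rho> v}" by blast
qed


section \<open>Standard monomials\<close>

text \<open>
  The generators outside the span of their predecessors form a basis.
\<close>

lemma (in vectorspace) dim_eq_card_new_generators:
  fixes f :: "'i::linorder \<Rightarrow> 'c"
  assumes I: "finite I" and fI: "f ` I \<subseteq> carrier V" and gen: "span (f ` I) = carrier V"
  shows "dim = card {x \<in> I. f x \<notin> span (f ` {y \<in> I. y < x})}"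
proof -
  define New where "New I = {x \<in> I. f x \<notin> span (f ` {y \<in> I. y < x})}" for I
  have "inj_on f (New I) \<and> lin_indpt (f ` New I) \<and> span (f ` New I) = span (f ` I)"
    using I fI
  proof (induction I rule: finite_linorder_max_induct)
    case empty
    have "lin_indpt {}" by (auto simp: lin_dep_def)
    then show ?case by (simp add: New_def)
  next
    case (insert b A)
    have AC: "f ` A \<subseteq> carrier V" "f b \<in> carrier V" using insert.prems by auto
    have IH: "inj_on f (New A)" "lin_indpt (f ` New A)" "span (f ` New A) = span (f ` A)"
      using insert.IH AC by auto
    have NA: "f ` New A \<subseteq> carrier V" "New A \<subseteq> A" using AC by (auto simp: New_def)
    have 1: "{y \<in> insert b A. y < b} = A" using insert.hyps by auto
    have 2: "{y \<in> insert b A. y < x} = {y \<in> A. y < x}" if "x \<in> A" for x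
      using insert.hyps that by (auto dest: less_asym)
    have b: "b \<notin> A" using insert.hyps by auto
    have New: "New (insert b A) = New A \<union> (if f b \<in> span (f ` A) then {} else {b})"
    proof (rule Set.set_eqI)
      fix x
      consider "x = b" | "x \<in> A" "x \<noteq> b" | "x \<notin> A" "x \<noteq> b" by blast
      then show "x \<in> New (insert b A) \<longleftrightarrow> x \<in> New A \<union> (if f b \<in> span (f ` A) then {} else {b})"
        by cases (simp_all add: New_def 1 2 1[unfolded insert_iff] 2[unfolded insert_iff] b)
    qed
    show ?case
    proof (cases "f b \<in> span (f ` A)")
      case True
      then have "span (f ` insert b A) = span (f ` A)" using already_in_span[OF AC(1) True] by simp
      then show ?thesis using True New IH by simp
    next
      case False
      have notin: "f b \<notin> f ` New A" using False in_own_span[OF NA(1)] IH(3) by blast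
      have "lin_indpt (f ` New A \<union> {f b})"
        using lin_dep_iff_in_span[OF NA(1) IH(2) AC(2) notin] False IH(3) by simp
      moreover have "span (f ` New A \<union> {f b}) = span (f ` A \<union> {f b})"
      proof
        show "span (f ` New A \<union> {f b}) \<subseteq> span (f ` A \<union> {f b})"
          using NA(2) by (intro span_is_monotone) auto
        have c: "f ` New A \<union> {f b} \<subseteq> carrier V" using NA AC by auto
        have "f ` A \<subseteq> span (f ` New A \<union> {f b})"
          using in_own_span[OF AC(1)] IH(3) span_is_monotone[of "f ` New A" "f ` New A \<union> {f b}"] by auto
        moreover have "f b \<in> span (f ` New A \<union> {f b})" using in_own_span[OF c] by auto
        ultimately show "span (f ` A \<union> {f b}) \<subseteq> span (f ` New A \<union> {f b})"
          by (intro span_is_subset span_is_submodule[OF c]) auto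
      qed
      moreover have "inj_on f (New A \<union> {b})" using IH(1) notin by auto
      ultimately show ?thesis using False New by (simp add: insert_commute)
    qed
  qed
  then have N: "inj_on f (New I)" "lin_indpt (f ` New I)" "span (f ` New I) = carrier V"
    using gen by auto
  have "basis (f ` New I)" using N fI by (auto simp: basis_def New_def)
  moreover have "finite (f ` New I)" using I by (simp add: New_def)
  ultimately have "dim = card (f ` New I)" by (intro dim_basis)
  then show ?thesis using N(1) by (simp add: card_image New_def)
qed

text \<open>
  The \<open>k\<close>-linear span inside a \<open>k[x,y]\<close>-module.  In contrast to the spans of the vector spaces
  \<open>component M G i\<close> it does not refer to a degree, so that it can be compared before and after
  multiplication by a monomial.
\<close>

inductive_set kspan :: "('k::field_char_0 poly poly, 'm) module \<Rightarrow> 'm set \<Rightarrow> 'm set"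
  for M :: "('k::field_char_0 poly poly, 'm) module" and B :: "'m set" where
  zero: "\<zero>\<^bsub>M\<^esub> \<in> kspan M B"
| add: "b \<in> B \<Longrightarrow> v \<in> kspan M B \<Longrightarrow> [:[:c:]:] \<odot>\<^bsub>M\<^esub> b \<oplus>\<^bsub>M\<^esub> v \<in> kspan M B"

context graded_module
begin

lemma const_homogeneous: "homogeneous n 0 [:[:c:]:]"
  by (auto simp: homogeneous_def coeff_pCons split: nat.splits)

lemma G_carrier: "v \<in> G i \<Longrightarrow> v \<in> carrier M"
  using component_subset by auto

lemma G_add: "v \<in> G i \<Longrightarrow> w \<in> G i \<Longrightarrow> v \<oplus>\<^bsub>M\<^esub> w \<in> G i"
  using subgroup.m_closed[OF component_subgroup[of i]] by simp

lemma G_zero: "\<zero>\<^bsub>M\<^esub> \<in> G i"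
  using subgroup.one_closed[OF component_subgroup[of i]] by simp

lemma G_scalar: "v \<in> G i \<Longrightarrow> [:[:c:]:] \<odot>\<^bsub>M\<^esub> v \<in> G i"
  using smult_homogeneous[OF const_homogeneous, of v i c] by simp

lemma scalar_closed: "v \<in> carrier M \<Longrightarrow> p \<odot>\<^bsub>M\<^esub> v \<in> carrier M"
  by (rule smult_closed) simp_all

lemma kspan_G:
  assumes "B \<subseteq> G i" "v \<in> kspan M B"
  shows "v \<in> G i"
  using assms(2) assms(1) by induction (auto intro: G_zero G_add G_scalar)

lemma kspan_carrier:
  assumes "B \<subseteq> carrier M" "v \<in> kspan M B"
  shows "v \<in> carrier M"
  using assms(2) assms(1) by induction (auto intro: scalar_closed)

lemma kspan_base:
  assumes "B \<subseteq> carrier M" "b \<in> B"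
  shows "b \<in> kspan M B"
proof -
  have "[:[:1:]:] \<odot>\<^bsub>M\<^esub> b \<oplus>\<^bsub>M\<^esub> \<zero>\<^bsub>M\<^esub> \<in> kspan M B" using assms by (intro kspan.intros)
  moreover have "[:[:1:]:] \<odot>\<^bsub>M\<^esub> b = b" using smult_one[of b] assms by (auto simp: one_pCons)
  ultimately show ?thesis using assms by auto
qed

lemma kspan_add:
  assumes B: "B \<subseteq> carrier M" and v: "v \<in> kspan M B" and w: "w \<in> kspan M B"
  shows "v \<oplus>\<^bsub>M\<^esub> w \<in> kspan M B"
  using v
proof induction
  case zero
  then show ?case using w kspan_carrier[OF B] by simp
next
  case (add b v c)
  have "([:[:c:]:] \<odot>\<^bsub>M\<^esub> b \<oplus>\<^bsub>M\<^esub> v) \<oplus>\<^bsub>M\<^esub> w = [:[:c:]:] \<odot>\<^bsub>M\<^esub> b \<oplus>\<^bsub>M\<^esub> (v \<oplus>\<^bsub>M\<^esub> w)"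
    using add B w kspan_carrier[OF B] by (intro M.a_assoc) (auto intro: scalar_closed)
  then show ?case using add by (auto intro: kspan.intros)
qed

lemma kspan_smult:
  assumes B: "B \<subseteq> carrier M" and B': "B' \<subseteq> carrier M" and img: "\<And>b. b \<in> B \<Longrightarrow> p \<odot>\<^bsub>M\<^esub> b \<in> kspan M B'"
    and v: "v \<in> kspan M B"
  shows "p \<odot>\<^bsub>M\<^esub> v \<in> kspan M B'"
proof -
  have scal: "[:[:c:]:] \<odot>\<^bsub>M\<^esub> u \<in> kspan M B'" if "u \<in> kspan M B'" for c u
    using that
  proof induction
    case zero
    have "[:[:c:]:] \<odot>\<^bsub>M\<^esub> \<zero>\<^bsub>M\<^esub> = \<zero>\<^bsub>M\<^esub>" by (rule smult_r_null) simp
    then show ?case by (simp add: kspan.zero)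
  next
    case (add b v a)
    have bv: "b \<in> carrier M" "v \<in> carrier M" using add B' kspan_carrier[OF B'] by auto
    have "[:[:c:]:] \<odot>\<^bsub>M\<^esub> ([:[:a:]:] \<odot>\<^bsub>M\<^esub> b \<oplus>\<^bsub>M\<^esub> v) = [:[:c:]:] \<odot>\<^bsub>M\<^esub> ([:[:a:]:] \<odot>\<^bsub>M\<^esub> b) \<oplus>\<^bsub>M\<^esub> [:[:c:]:] \<odot>\<^bsub>M\<^esub> v"
      using bv by (intro smult_r_distr) (auto intro: scalar_closed)
    also have "[:[:c:]:] \<odot>\<^bsub>M\<^esub> ([:[:a:]:] \<odot>\<^bsub>M\<^esub> b) = [:[:c * a:]:] \<odot>\<^bsub>M\<^esub> b"
      using smult_assoc1[of "[:[:c:]:]" "[:[:a:]:]" b] bv by simp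
    finally show ?case using add by (auto intro: kspan.intros)
  qed
  show ?thesis
    using v
  proof induction
    case zero
    have "p \<odot>\<^bsub>M\<^esub> \<zero>\<^bsub>M\<^esub> = \<zero>\<^bsub>M\<^esub>" by (rule smult_r_null) simp
    then show ?case by (simp add: kspan.zero)
  next
    case (add b v c)
    have bv: "b \<in> carrier M" "v \<in> carrier M" using add B kspan_carrier[OF B] by auto
    have "p \<odot>\<^bsub>M\<^esub> ([:[:c:]:] \<odot>\<^bsub>M\<^esub> b \<oplus>\<^bsub>M\<^esub> v) = p \<odot>\<^bsub>M\<^esub> ([:[:c:]:] \<odot>\<^bsub>M\<^esub> b) \<oplus>\<^bsub>M\<^esub> p \<odot>\<^bsub>M\<^esub> v"
      using bv by (intro smult_r_distr) (auto intro: scalar_closed)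
    also have "p \<odot>\<^bsub>M\<^esub> ([:[:c:]:] \<odot>\<^bsub>M\<^esub> b) = [:[:c:]:] \<odot>\<^bsub>M\<^esub> (p \<odot>\<^bsub>M\<^esub> b)"
      using smult_assoc1[of "[:[:c:]:]" p b] smult_assoc1[of p "[:[:c:]:]" b] bv by (simp add: mult.commute)
    finally show ?case using add img[OF add(1)] kspan_add[OF B'] scal by auto
  qed
qed

lemma component_span:
  assumes B: "B \<subseteq> G i"
  shows "LinearCombinations.module.span (class_ring :: 'k ring) (component M G i) B = kspan M B"
proof -
  interpret V: vectorspace "class_ring :: 'k ring" "component M G i" by (rule vectorspace_component)
  have sel [simp]: "carrier (component M G i) = G i" "zero (component M G i) = \<zero>\<^bsub>M\<^esub>"
    "add (component M G i) = add M" "smult (component M G i) = (\<lambda>c. smult M [:[:c:]:])"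
    by (simp_all add: component_def)
  have BC: "B \<subseteq> carrier M" using B G_carrier by auto
  have Bc: "B \<subseteq> carrier (component M G i)" using B by simp
  note sub = V.span_is_submodule[OF Bc]
  show ?thesis
  proof
    have "LinearCombinations.submodule (class_ring :: 'k ring) (kspan M B) (component M G i)"
    proof (intro LinearCombinations.submodule.intro V.module_axioms)
      show "kspan M B \<subseteq> carrier (component M G i)" using kspan_G[OF B] by auto
      show "v \<oplus>\<^bsub>component M G i\<^esub> w \<in> kspan M B" if "v \<in> kspan M B" "w \<in> kspan M B" for v w
        using kspan_add[OF BC that] by simp
      show "\<zero>\<^bsub>component M G i\<^esub> \<in> kspan M B" by (simp add: kspan.zero)
      show "c \<odot>\<^bsub>component M G i\<^esub> v \<in> kspan M B" if "v \<in> kspan M B" for c v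
      proof -
        have "[:[:c:]:] \<odot>\<^bsub>M\<^esub> b \<in> kspan M B" if "b \<in> B" for b
        proof -
          have "[:[:c:]:] \<odot>\<^bsub>M\<^esub> b \<oplus>\<^bsub>M\<^esub> \<zero>\<^bsub>M\<^esub> \<in> kspan M B" using that by (intro kspan.intros)
          then show ?thesis using that BC scalar_closed by (metis M.r_zero subsetD)
        qed
        from kspan_smult[OF BC BC this that] show ?thesis by simp
      qed
    qed
    then show "V.span B \<subseteq> kspan M B" using kspan_base[OF BC] by (intro V.span_is_subset) auto
    show "kspan M B \<subseteq> V.span B"
    proof
      fix v assume "v \<in> kspan M B"
      then show "v \<in> V.span B"
      proof induction
        case zero
        show ?case using LinearCombinations.submodule.zero_closed[OF sub] by simp
      next
        case (add b v c)
        have "b \<in> V.span B" using V.in_own_span[OF Bc] add by auto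
        then have "[:[:c:]:] \<odot>\<^bsub>M\<^esub> b \<in> V.span B"
          using LinearCombinations.submodule.smult_closed[OF sub, of c b] by simp
        then show ?case using LinearCombinations.submodule.m_closed[OF sub] add by simp
      qed
    qed
  qed
qed

lemma hilbert_function_eq_card:
  fixes f :: "'i::linorder \<Rightarrow> 'm"
  assumes "finite I" and f: "f ` I \<subseteq> G i" and gen: "G i \<subseteq> kspan M (f ` I)"
  shows "hilbert_function M G i = card {x \<in> I. f x \<notin> kspan M (f ` {y \<in> I. y < x})}"
proof -
  interpret V: vectorspace "class_ring :: 'k ring" "component M G i" by (rule vectorspace_component)
  have "V.span (f ` {y \<in> I. y < x}) = kspan M (f ` {y \<in> I. y < x})" for x
    using f by (intro component_span) auto
  moreover have "V.span (f ` I) = carrier (component M G i)"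
    using component_span[OF f] gen kspan_G[OF f] by (auto simp: component_def)
  ultimately show ?thesis
    using V.dim_eq_card_new_generators[OF assms(1), of f] f by (simp add: hilbert_function_def component_def)
qed


lemma sum_smult_closed:
  assumes v: "v \<in> carrier M" and zero: "\<zero>\<^bsub>M\<^esub> \<in> U" and add: "\<And>x y. x \<in> U \<Longrightarrow> y \<in> U \<Longrightarrow> x \<oplus>\<^bsub>M\<^esub> y \<in> U"
    and q: "\<And>x. x \<in> A \<Longrightarrow> q x \<odot>\<^bsub>M\<^esub> v \<in> U"
  shows "sum q A \<odot>\<^bsub>M\<^esub> v \<in> U"
  using q
proof (induction A rule: infinite_finite_induct)
  case (insert x A)
  have "(q x + sum q A) \<odot>\<^bsub>M\<^esub> v = q x \<odot>\<^bsub>M\<^esub> v \<oplus>\<^bsub>M\<^esub> sum q A \<odot>\<^bsub>M\<^esub> v"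
    using smult_l_distr[of "q x" "sum q A" v] v by simp
  then show ?case using insert add by simp
qed (use zero smult_l_null[OF v] in \<open>auto simp: class_ring_simps\<close>)

end

abbreviation xy_monom :: "nat \<Rightarrow> nat \<Rightarrow> 'k::field_char_0 poly poly" where
  "xy_monom a j \<equiv> monom (monom 1 a) j"

lemma homogeneous_mono: "homogeneous n (a + n * j) (xy_monom a j)"
  by (auto simp: homogeneous_def split: if_splits)

lemma mono_mult: "xy_monom a j * xy_monom a' j' = xy_monom (a + a') (j + j')"
  by (simp add: mult_monom)

lemma poly_poly_as_sum:
  "p = (\<Sum>j\<le>degree p. \<Sum>a\<le>degree (coeff p j). [:[:coeff (coeff p j) a:]:] * xy_monom a j)"
proof -
  have inner: "(\<Sum>a\<le>degree q. [:[:coeff q a:]:] * xy_monom a j) = monom q j" for q :: "'a poly" and j :: nat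
  proof -
    have "(\<Sum>a\<le>degree q. [:[:coeff q a:]:] * xy_monom a j) = (\<Sum>a\<le>degree q. monom (monom (coeff q a) a) j)"
      by (intro sum.cong) (auto simp: smult_monom)
    also have "\<dots> = monom (\<Sum>a\<le>degree q. monom (coeff q a) a) j"
      by (rule poly_eqI) (simp add: coeff_sum)
    finally show ?thesis by (simp add: poly_as_sum_of_monoms)
  qed
  show ?thesis unfolding inner by (rule poly_as_sum_of_monoms[symmetric])
qed

context graded_module
begin

text \<open>
  The sums of elements of the spaces \<open>W i\<close> contain all multiples of the generators and hence the
  whole module.  Since \<open>W i\<close> lies in degree \<open>i\<close>, uniqueness of the homogeneous decomposition
  shows that a homogeneous element of degree \<open>i\<close> is its own summand in \<open>W i\<close>.
\<close>

lemma components_generate: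
  fixes g :: "nat \<Rightarrow> 'm"
  assumes gG: "g ` {..<N} \<subseteq> G 0" and gen: "span (g ` {..<N}) = carrier M"
    and W: "\<And>i. W i = kspan M {xy_monom a j \<odot>\<^bsub>M\<^esub> g k | k a j. k < N \<and> a + n * j = i}"
  shows "G i \<subseteq> W i"
proof
  have gc: "g k \<in> carrier M" if "k < N" for k using gG that G_carrier by auto
  have BG: "{xy_monom a j \<odot>\<^bsub>M\<^esub> g k | k a j. k < N \<and> a + n * j = i} \<subseteq> G i" for i
    using smult_homogeneous[OF homogeneous_mono, of _ 0] gG by fastforce
  then have BC: "{xy_monom a j \<odot>\<^bsub>M\<^esub> g k | k a j. k < N \<and> a + n * j = i} \<subseteq> carrier M" for i
    using G_carrier by blast
  have WG: "v \<in> W i \<Longrightarrow> v \<in> G i" for v i using kspan_G[OF BG] unfolding W by blast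
  have WC: "v \<in> W i \<Longrightarrow> v \<in> carrier M" for v i using WG G_carrier by blast
  have W0: "\<zero>\<^bsub>M\<^esub> \<in> W i" for i unfolding W by (rule kspan.zero)
  have Wadd: "v \<oplus>\<^bsub>M\<^esub> w \<in> W i" if "v \<in> W i" "w \<in> W i" for v w i
    using that kspan_add[OF BC] unfolding W by blast
  define decomp where "decomp F B v \<longleftrightarrow> (\<forall>i. F i \<in> W i) \<and> (\<forall>i>B. F i = \<zero>\<^bsub>M\<^esub>) \<and>
    v = (\<Oplus>\<^bsub>M\<^esub>i\<in>{..B}. F i)" for F and B :: nat and v
  define U where "U = {v. \<exists>F B. decomp F B v}"
  have extend: "(\<Oplus>\<^bsub>M\<^esub>i\<in>{..B}. F i) = (\<Oplus>\<^bsub>M\<^esub>i\<in>{..B'}. F i)"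
    if "\<forall>i. F i \<in> W i" "\<forall>i>B. F i = \<zero>\<^bsub>M\<^esub>" "B \<le> B'" for F and B B' :: nat
    using that WC by (intro M.add.finprod_mono_neutral_cong_left) auto
  have U_add: "v \<oplus>\<^bsub>M\<^esub> w \<in> U" if uv: "v \<in> U" "w \<in> U" for v w
  proof -
    obtain F B where "decomp F B v" using uv(1) unfolding U_def by blast
    then have F: "\<forall>i. F i \<in> W i" "\<forall>i>B. F i = \<zero>\<^bsub>M\<^esub>" "v = (\<Oplus>\<^bsub>M\<^esub>i\<in>{..B}. F i)"
      by (simp_all add: decomp_def)
    obtain F' B' where "decomp F' B' w" using uv(2) unfolding U_def by blast
    then have F': "\<forall>i. F' i \<in> W i" "\<forall>i>B'. F' i = \<zero>\<^bsub>M\<^esub>" "w = (\<Oplus>\<^bsub>M\<^esub>i\<in>{..B'}. F' i)"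
      by (simp_all add: decomp_def)
    let ?B = "max B B'"
    have v: "v = (\<Oplus>\<^bsub>M\<^esub>i\<in>{..?B}. F i)" unfolding F(3) by (rule extend[OF F(1,2)]) simp
    have w: "w = (\<Oplus>\<^bsub>M\<^esub>i\<in>{..?B}. F' i)" unfolding F'(3) by (rule extend[OF F'(1,2)]) simp
    have "v \<oplus>\<^bsub>M\<^esub> w = (\<Oplus>\<^bsub>M\<^esub>i\<in>{..?B}. F i \<oplus>\<^bsub>M\<^esub> F' i)"
      unfolding v w using F(1) F'(1) WC by (intro M.finsum_addf[symmetric]) blast+
    moreover have "\<forall>i. F i \<oplus>\<^bsub>M\<^esub> F' i \<in> W i" using F(1) F'(1) Wadd by blast
    moreover have "\<forall>i>?B. F i \<oplus>\<^bsub>M\<^esub> F' i = \<zero>\<^bsub>M\<^esub>" using F(2) F'(2) by simp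
    ultimately have "decomp (\<lambda>i. F i \<oplus>\<^bsub>M\<^esub> F' i) ?B (v \<oplus>\<^bsub>M\<^esub> w)" by (simp add: decomp_def)
    then show ?thesis unfolding U_def by blast
  qed
  have W_U: "v \<in> U" if "v \<in> W i" for v i
  proof -
    let ?F = "\<lambda>i'. if i' = i then v else \<zero>\<^bsub>M\<^esub>"
    have "(\<Oplus>\<^bsub>M\<^esub>i'\<in>{..i}. ?F i') = v"
      using M.add.finprod_singleton_swap[of i "{..i}" "\<lambda>_. v"] WC[OF that] by simp
    moreover have "\<forall>i. ?F i \<in> W i" using that W0 by simp
    moreover have "\<forall>i'>i. ?F i' = \<zero>\<^bsub>M\<^esub>" by simp
    ultimately have "decomp ?F i v" by (simp add: decomp_def)
    then show ?thesis unfolding U_def by blast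
  qed
  have U0: "\<zero>\<^bsub>M\<^esub> \<in> U" using W_U[OF W0] .
  have pU: "p \<odot>\<^bsub>M\<^esub> g k \<in> U" if k: "k < N" for p k
  proof -
    have "([:[:c:]:] * xy_monom a j) \<odot>\<^bsub>M\<^esub> g k \<in> U" for c a j
    proof -
      have "([:[:c:]:] * xy_monom a j) \<odot>\<^bsub>M\<^esub> g k = [:[:c:]:] \<odot>\<^bsub>M\<^esub> (xy_monom a j \<odot>\<^bsub>M\<^esub> g k) \<oplus>\<^bsub>M\<^esub> \<zero>\<^bsub>M\<^esub>"
        using smult_assoc1[of "[:[:c:]:]" "xy_monom a j" "g k"] gc[OF k] scalar_closed by simp
      also have "\<dots> \<in> W (a + n * j)" unfolding W using k by (intro kspan.intros) blast
      finally show ?thesis by (rule W_U)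
    qed
    then have "(\<Sum>j\<le>degree p. \<Sum>a\<le>degree (coeff p j). [:[:coeff (coeff p j) a:]:] * xy_monom a j) \<odot>\<^bsub>M\<^esub> g k \<in> U"
      by (intro sum_smult_closed[OF gc[OF k] U0 U_add])
    then show ?thesis using poly_poly_as_sum[of p] by simp
  qed
  have all: "carrier M \<subseteq> U"
  proof
    fix v assume "v \<in> carrier M"
    then obtain p where v: "v = lincomb p (g ` {..<N})"
      using finite_in_span[of "g ` {..<N}" v] gen gc by auto
    have "(\<Oplus>\<^bsub>M\<^esub>x\<in>A. p x \<odot>\<^bsub>M\<^esub> x) \<in> U" if "finite A" "A \<subseteq> g ` {..<N}" for A
      using that
    proof (induction A rule: finite_induct)
      case (insert x A)
      have "(\<Oplus>\<^bsub>M\<^esub>x\<in>insert x A. p x \<odot>\<^bsub>M\<^esub> x) = p x \<odot>\<^bsub>M\<^esub> x \<oplus>\<^bsub>M\<^esub> (\<Oplus>\<^bsub>M\<^esub>x\<in>A. p x \<odot>\<^bsub>M\<^esub> x)"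
        using insert gc by (intro M.finsum_insert) (auto intro!: scalar_closed)
      moreover have "p x \<odot>\<^bsub>M\<^esub> x \<in> U" using insert pU by auto
      ultimately show ?case using insert U_add by simp
    qed (simp add: U0)
    then show "v \<in> U" unfolding v lincomb_def by simp
  qed
  fix v assume v: "v \<in> G i"
  then have vc: "v \<in> carrier M" by (rule G_carrier)
  then obtain F B where "decomp F B v" using all unfolding U_def by blast
  then have F: "\<forall>i. F i \<in> W i" "\<forall>i>B. F i = \<zero>\<^bsub>M\<^esub>" "v = (\<Oplus>\<^bsub>M\<^esub>i\<in>{..B}. F i)"
    by (simp_all add: decomp_def)
  define P where "P f \<longleftrightarrow> (\<forall>i. f i \<in> G i) \<and> finite {i. f i \<noteq> \<zero>\<^bsub>M\<^esub>} \<and> v = (\<Oplus>\<^bsub>M\<^esub>i\<in>{i. f i \<noteq> \<zero>\<^bsub>M\<^esub>}. f i)" for f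
  have unique: "\<exists>!f. P f" using direct_sum_components[OF vc] unfolding P_def .
  have "P F"
    unfolding P_def
  proof (intro conjI)
    show "\<forall>i. F i \<in> G i" using F(1) WG by blast
    have sub: "{i. F i \<noteq> \<zero>\<^bsub>M\<^esub>} \<subseteq> {..B}" using F(2) by (auto simp: not_less[symmetric])
    then show "finite {i. F i \<noteq> \<zero>\<^bsub>M\<^esub>}" by (rule finite_subset) simp
    show "v = (\<Oplus>\<^bsub>M\<^esub>i\<in>{i. F i \<noteq> \<zero>\<^bsub>M\<^esub>}. F i)"
      unfolding F(3) using sub F(1) WC by (intro M.add.finprod_mono_neutral_cong_right) auto
  qed
  moreover have "P (\<lambda>i'. if i' = i then v else \<zero>\<^bsub>M\<^esub>)"
  proof (cases "v = \<zero>\<^bsub>M\<^esub>")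
    case True
    then show ?thesis using G_zero by (simp add: P_def)
  next
    case False
    then have "{i'. (if i' = i then v else \<zero>\<^bsub>M\<^esub>) \<noteq> \<zero>\<^bsub>M\<^esub>} = {i}" by auto
    then show ?thesis using G_zero v vc by (simp add: P_def)
  qed
  ultimately have "F = (\<lambda>i'. if i' = i then v else \<zero>\<^bsub>M\<^esub>)"
    using unique by blast
  then have "F i = v" by simp
  then show "v \<in> W i" using F(1) by metis
qed

end

text \<open>
  A bounded set of monomials that is closed under division by \<open>x\<close> and by \<open>y\<close> is a diagram, unless
  it is empty; \<open>P a j\<close> stands for \<open>x^a y^j\<close> belonging to it.
\<close>

lemma staircase_rows:
  assumes x: "\<And>a j. P (Suc a) j \<Longrightarrow> P a j" and y: "\<And>a j. P a (Suc j) \<Longrightarrow> P a j"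
    and top: "\<And>a j. P a j \<Longrightarrow> a + n * j \<le> d"
  shows "\<exists>b. (\<forall>a j. P a j \<longleftrightarrow> a < b j) \<and> antimono b \<and> (\<forall>j. 0 < b j \<longrightarrow> b j + n * j \<le> d + 1)"
proof -
  define b where "b j = (LEAST a. \<not> P a j)" for j
  have "\<not> P (Suc d) j" for j using top[of "Suc d" j] by auto
  then have not: "\<not> P (b j) j" for j unfolding b_def by (rule LeastI)
  have down: "P a j" if "P a' j" "a \<le> a'" for a a' j
    using that(2,1) by (induction a rule: inc_induct) (auto intro: x)
  have P: "P a j \<longleftrightarrow> a < b j" for a j
  proof
    show "P a j \<Longrightarrow> a < b j" using down[of a j "b j"] not[of j] by (meson not_le)
    show "a < b j \<Longrightarrow> P a j" unfolding b_def using not_less_Least by blast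
  qed
  have "b (Suc j) \<le> b j" for j
    using P[of "b j" "Suc j"] P[of "b j" j] y[of "b j" j] by (meson less_irrefl not_le)
  then have "antimono b" by (simp add: antimono_iff_le_Suc)
  moreover have "b j + n * j \<le> d + 1" if "0 < b j" for j
    using top[of "b j - 1" j] P[of "b j - 1" j] that by simp
  ultimately show ?thesis using P by blast
qed

context graded_module
begin

text \<open>
  In degree \<open>i\<close>, the products of monomials with the generators \<open>g k\<close> are indexed by pairs
  \<open>(k, j)\<close>, which stand for \<open>x^(i - n j) y^j\<close> times \<open>g k\<close>, and are ordered lexicographically.  A
  pair is standard if its product is not a combination of the products of smaller pairs; the number
  of standard pairs is the dimension.  Multiplication by a monomial preserves the order, so a multiple
  of a nonstandard product is nonstandard.  Hence the standard monomials of each generator form a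
  diagram or the empty set.
\<close>

lemma hilbert_function_eq_sum_diagrams:
  fixes d :: nat
  assumes n: "1 \<le> n" and fg: "fin_gen_degree_0" and top: "\<And>i. d < i \<Longrightarrow> hilbert_function M G i = 0"
  shows "(\<lambda>i. of_nat (hilbert_function M G i)) \<in> diagram_cone n d"
proof -
  obtain S where S: "finite S" "S \<subseteq> G 0" "span S = carrier M"
    using fg unfolding fin_gen_degree_0_def by blast
  obtain N and g :: "nat \<Rightarrow> 'm" where "S = g ` {i. i < N}"
    using finite_imp_nat_seg_image_inj_on[OF S(1)] by blast
  then have g: "g ` {..<N} = S" by (simp add: lessThan_def)
  have gG: "g ` {..<N} \<subseteq> G 0" and gen: "span (g ` {..<N}) = carrier M" using S g by auto
  define I where "I i = {(k, j). k < N \<and> n * j \<le> i}" for i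
  define f where "f i = (\<lambda>(k, j). xy_monom (i - n * j) j \<odot>\<^bsub>M\<^esub> g k)" for i
  define std where "std i x \<longleftrightarrow> x \<in> I i \<and> f i x \<notin> kspan M (f i ` {y \<in> I i. y < x})" for i x
  have I_sub: "I i \<subseteq> {..<N} \<times> {..i}" for i
  proof -
    have "j \<le> n * j" for j using n by simp
    from le_trans[OF this] show ?thesis by (auto simp: I_def)
  qed
  have fin: "finite (I i)" for i using I_sub by (rule finite_subset) simp
  have fG: "f i ` I i \<subseteq> G i" for i
  proof
    fix v assume "v \<in> f i ` I i"
    then obtain k j where kj: "k < N" "n * j \<le> i" "v = xy_monom (i - n * j) j \<odot>\<^bsub>M\<^esub> g k"
      by (auto simp: I_def f_def)
    have "g k \<in> G 0" using gG kj(1) by auto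
    from smult_homogeneous[OF homogeneous_mono this, of "i - n * j" j] kj(2,3) show "v \<in> G i" by simp
  qed
  have gens: "{xy_monom a j \<odot>\<^bsub>M\<^esub> g k | k a j. k < N \<and> a + n * j = i} = f i ` I i" for i
  proof (intro equalityI subsetI)
    fix v assume "v \<in> {xy_monom a j \<odot>\<^bsub>M\<^esub> g k | k a j. k < N \<and> a + n * j = i}"
    then obtain k a j where "v = xy_monom a j \<odot>\<^bsub>M\<^esub> g k" "k < N" "a + n * j = i" by blast
    then have "v = f i (k, j)" "(k, j) \<in> I i" by (auto simp: f_def I_def)
    then show "v \<in> f i ` I i" by blast
  next
    fix v assume "v \<in> f i ` I i"
    then obtain k j where "v = xy_monom (i - n * j) j \<odot>\<^bsub>M\<^esub> g k" "k < N" "n * j \<le> i" by (auto simp: f_def I_def)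
    then show "v \<in> {xy_monom a j \<odot>\<^bsub>M\<^esub> g k | k a j. k < N \<and> a + n * j = i}"
      by (intro CollectI exI[of _ k] exI[of _ "i - n * j"] exI[of _ j]) simp
  qed
  have hf: "hilbert_function M G i = card {x. std i x}" for i
  proof -
    have "G i \<subseteq> kspan M (f i ` I i)" using components_generate[OF gG gen refl, of i] unfolding gens .
    from hilbert_function_eq_card[OF fin fG this] show ?thesis by (simp add: std_def)
  qed
  have std_fin: "finite {x. std i x}" for i using fin[of i] by (rule rev_finite_subset) (auto simp: std_def)
  \<comment> \<open>Divisors of standard monomials are standard: multiply a relation by the complementary monomial.\<close>
  have shift: "std i (k, j)" if std: "std (i + (a' + n * j')) (k, j + j')" and kj: "n * j \<le> i" for i k j a' j'
  proof (rule ccontr)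
    let ?i = "i + (a' + n * j')"
    have k: "k < N" using std by (auto simp: std_def I_def)
    then have I1: "(k, j) \<in> I i" using kj by (simp add: I_def)
    assume "\<not> std i (k, j)"
    then have mem: "f i (k, j) \<in> kspan M (f i ` {y \<in> I i. y < (k, j)})" using I1 by (simp add: std_def)
    have sc: "f i ` {y \<in> I i. y < x} \<subseteq> carrier M" for i x using fG[of i] G_carrier by auto
    have mv: "xy_monom a' j' \<odot>\<^bsub>M\<^esub> f i (k1, j1) = f ?i (k1, j1 + j')" if "(k1, j1) \<in> I i" for k1 j1
    proof -
      have "g k1 \<in> carrier M" "n * j1 \<le> i" using that gG G_carrier by (auto simp: I_def)
      moreover have "?i - n * (j1 + j') = a' + (i - n * j1)" using \<open>n * j1 \<le> i\<close> by (simp add: algebra_simps)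
      ultimately show ?thesis
        using smult_assoc1[of "xy_monom a' j'" "xy_monom (i - n * j1) j1" "g k1"]
        by (simp add: f_def mono_mult add.commute)
    qed
    have "xy_monom a' j' \<odot>\<^bsub>M\<^esub> f i (k, j) \<in> kspan M (f ?i ` {y \<in> I ?i. y < (k, j + j')})"
    proof (rule kspan_smult[OF sc sc _ mem])
      fix u assume "u \<in> f i ` {y \<in> I i. y < (k, j)}"
      then obtain k1 j1 where y: "(k1, j1) \<in> I i" "(k1, j1) < (k, j)" "u = f i (k1, j1)" by auto
      have "(k1, j1 + j') \<in> I ?i" using y(1) by (auto simp: I_def algebra_simps)
      moreover have "(k1, j1 + j') < (k, j + j')" using y(2) by (auto simp: less_prod_def)
      ultimately show "xy_monom a' j' \<odot>\<^bsub>M\<^esub> u \<in> kspan M (f ?i ` {y \<in> I ?i. y < (k, j + j')})"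
        unfolding y(3) mv[OF y(1)] by (intro kspan_base[OF sc]) blast
    qed
    then show False using std mv[OF I1] by (simp add: std_def)
  qed
  have "\<exists>b. (\<forall>a j. std (a + n * j) (k, j) \<longleftrightarrow> a < b j) \<and> antimono b \<and> (\<forall>j. 0 < b j \<longrightarrow> b j + n * j \<le> d + 1)" for k
  proof -
    have 1: "std (a + n * j) (k, j)" if "std (Suc a + n * j) (k, j)" for a j
      using shift[of "a + n * j" 1 0 k j] that by simp
    have 2: "std (a + n * j) (k, j)" if "std (a + n * Suc j) (k, Suc j)" for a j
      using shift[of "a + n * j" 0 1 k j] that by (simp add: algebra_simps)
    have 3: "a + n * j \<le> d" if "std (a + n * j) (k, j)" for a j
    proof (rule ccontr)
      assume "\<not> a + n * j \<le> d"
      then have "{x. std (a + n * j) x} = {}" using top[of "a + n * j"] hf std_fin by simp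
      then show False using that by blast
    qed
    show ?thesis by (rule staircase_rows) (fact 1, fact 2, fact 3)
  qed
  from choice[OF allI[OF this]] obtain b where b_all: "\<forall>k. (\<forall>a j. std (a + n * j) (k, j) \<longleftrightarrow> a < b k j) \<and>
    antimono (b k) \<and> (\<forall>j. 0 < b k j \<longrightarrow> b k j + n * j \<le> d + 1)" ..
  have b: "\<And>k a j. std (a + n * j) (k, j) \<longleftrightarrow> a < b k j" "\<And>k. antimono (b k)"
    "\<And>k j. 0 < b k j \<Longrightarrow> b k j + n * j \<le> d + 1" using b_all by simp_all
  have "of_nat (hilbert_function M G i) = (\<Sum>k<N. diagram_vec n (b k) i)" for i
  proof -
    have rows: "std i (k, j) \<longleftrightarrow> k < N \<and> n * j \<le> i \<and> i < b k j + n * j" for k j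
    proof (cases "k < N \<and> n * j \<le> i")
      case True
      then show ?thesis using b(1)[of "i - n * j" j k] by auto
    next
      case False
      then show ?thesis by (auto simp: std_def I_def)
    qed
    have "{x. std i x} = (SIGMA k:{..<N}. {j. n * j \<le> i \<and> i < b k j + n * j})"
      using rows by auto
    moreover have "finite {j. n * j \<le> i \<and> i < b k j + n * j}" for k by (rule finite_rows[OF n])
    ultimately have "hilbert_function M G i = (\<Sum>k<N. diagram_count n (b k) i)"
      unfolding hf by (simp add: card_SigmaI diagram_count_def)
    then show ?thesis by (simp add: diagram_vec_def)
  qed
  moreover have "diagram_vec n (b k) \<in> diagram_cone n d" for k
  proof (cases "b k 0 = 0")
    case True
    then have "b k j = 0" for j using antimonoD[OF b(2)[of k], of 0 j] by simp
    then have "b k = (\<lambda>_. 0)" by (rule ext)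
    then show ?thesis by (simp add: diagram_vec_empty[OF n] diagram_cone_zero)
  next
    case False
    then have "b k \<in> diagrams n d" using b(2,3) by (simp add: diagrams_def)
    then show ?thesis using diagram_coneI[OF n, of "b k" d 1] by simp
  qed
  ultimately show ?thesis
    using diagram_cone_sum[of "{..<N}" "\<lambda>k. diagram_vec n (b k)" n d] by simp
qed

end


section \<open>Diagrams as quotients of the polynomial ring\<close>

text \<open>
  Exponent pairs are written with the exponent of \<open>y\<close> first, as in \<open>coeff (coeff v j) a\<close>.
\<close>

abbreviation xy_coeff :: "'k::field_char_0 poly poly \<Rightarrow> nat \<times> nat \<Rightarrow> 'k" where
  "xy_coeff v c \<equiv> coeff (coeff v (fst c)) (snd c)"

text \<open>
  The quotient of \<open>k[x,y]\<close> by the monomial ideal spanned by the monomials outside the diagram is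
  modelled by the polynomials supported in the diagram; \<open>diagram_truncate b\<close> takes a polynomial to the
  representative of its class.
\<close>

definition diagram_truncate :: "(nat \<Rightarrow> nat) \<Rightarrow> 'k::field_char_0 poly poly \<Rightarrow> 'k poly poly" where
  "diagram_truncate b v = (\<Sum>j\<le>degree v. monom (poly_cutoff (b j) (coeff v j)) j)"

lemma coeff_truncate: "coeff (coeff (diagram_truncate b v) j) a = (if a < b j then coeff (coeff v j) a else 0)"
proof -
  have "coeff (diagram_truncate b v) j = (\<Sum>i\<le>degree v. if i = j then poly_cutoff (b i) (coeff v i) else 0)"
    by (simp add: diagram_truncate_def coeff_sum)
  also have "\<dots> = (if j \<le> degree v then poly_cutoff (b j) (coeff v j) else 0)"
    by (simp add: sum.delta)
  also have "\<dots> = poly_cutoff (b j) (coeff v j)" by (auto simp: coeff_eq_0)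
  finally show ?thesis by (simp add: coeff_poly_cutoff)
qed

definition diagram_polys :: "(nat \<Rightarrow> nat) \<Rightarrow> 'k::field_char_0 poly poly set" where
  "diagram_polys b = {v. \<forall>j a. b j \<le> a \<longrightarrow> coeff (coeff v j) a = 0}"

lemma truncate_in: "diagram_truncate b v \<in> diagram_polys b"
  by (auto simp: diagram_polys_def coeff_truncate)

lemma truncate_ident: "v \<in> diagram_polys b \<Longrightarrow> diagram_truncate b v = v"
  by (auto simp: diagram_polys_def poly_eq_iff coeff_truncate not_less)

lemma truncate_add: "diagram_truncate b (v + w) = diagram_truncate b v + diagram_truncate b w"
  by (auto simp: poly_eq_iff coeff_truncate)

lemma diagram_polys_add: "v \<in> diagram_polys b \<Longrightarrow> w \<in> diagram_polys b \<Longrightarrow> v + w \<in> diagram_polys b"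
  by (simp add: diagram_polys_def)

text \<open>
  The monomials outside the diagram span an ideal: a monomial of \<open>p * v\<close> inside the diagram only
  involves monomials of \<open>v\<close> inside the diagram.
\<close>

lemma truncate_mult_truncate:
  assumes "antimono b"
  shows "diagram_truncate b (p * diagram_truncate b v) = diagram_truncate b (p * v)"
proof -
  define u where "u = v - diagram_truncate b v"
  have u: "coeff (coeff u j) a = 0" if "a < b j" for j a
    using that by (simp add: u_def coeff_truncate)
  have "coeff (coeff (p * u) j) a = 0" if "a < b j" for j a
  proof -
    have "coeff (coeff p i * coeff u (j - i)) a = 0" for i
    proof -
      have "b j \<le> b (j - i)" using assms by (simp add: antimonoD)
      then have "coeff (coeff u (j - i)) (a - k) = 0" for k using that by (intro u) linarith
      then show ?thesis by (simp add: coeff_mult)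
    qed
    then show ?thesis by (simp add: coeff_mult[of p u] coeff_sum)
  qed
  then have "diagram_truncate b (p * u) = 0" by (auto simp: poly_eq_iff coeff_truncate)
  moreover have "p * v = p * diagram_truncate b v + p * u" by (simp add: u_def algebra_simps)
  ultimately show ?thesis by (simp add: truncate_add)
qed

text \<open>
  The fields \<open>mult\<close> and \<open>one\<close> belong to the record type of modules but carry no meaning for a module;
  they are filled with \<open>0\<close>.
\<close>

definition diagram_module :: "(nat \<Rightarrow> nat) \<Rightarrow> ('k::field_char_0 poly poly, 'k poly poly) module" where
  "diagram_module b = \<lparr>carrier = diagram_polys b, mult = (\<lambda>_ _. 0), one = 0, zero = 0, add = (+),
     smult = (\<lambda>p v. diagram_truncate b (p * v))\<rparr>"

lemma diagram_module_sel [simp]: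
  "carrier (diagram_module b) = diagram_polys b" "zero (diagram_module b) = 0"
  "add (diagram_module b) = (+)" "smult (diagram_module b) p v = diagram_truncate b (p * v)"
  by (simp_all add: diagram_module_def)

lemma diagram_module_module:
  assumes b: "antimono b"
  shows "Module.module (class_ring :: 'k::field_char_0 poly poly ring) (diagram_module b)"
proof (rule module_criteria)
  let ?M = "diagram_module b :: ('k poly poly, 'k poly poly) module"
  show "cring (class_ring :: 'k poly poly ring)" by (rule class_cring.cring_axioms)
  show "\<forall>v\<in>carrier ?M. \<exists>w\<in>carrier ?M. v \<oplus>\<^bsub>?M\<^esub> w = \<zero>\<^bsub>?M\<^esub>"
  proof
    fix v :: "'k poly poly" assume "v \<in> carrier ?M"
    then have "- v \<in> diagram_polys b" by (simp add: diagram_polys_def)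
    then show "\<exists>w\<in>carrier ?M. v \<oplus>\<^bsub>?M\<^esub> w = \<zero>\<^bsub>?M\<^esub>" by (intro bexI[of _ "- v"]) simp_all
  qed
  show "\<forall>p q v. p \<in> carrier class_ring \<and> q \<in> carrier class_ring \<and> v \<in> carrier ?M \<longrightarrow>
    (p \<otimes>\<^bsub>class_ring\<^esub> q) \<odot>\<^bsub>?M\<^esub> v = p \<odot>\<^bsub>?M\<^esub> (q \<odot>\<^bsub>?M\<^esub> v)"
    by (simp add: truncate_mult_truncate[OF b] mult.assoc)
  show "\<zero>\<^bsub>?M\<^esub> \<in> carrier ?M" by (simp add: diagram_polys_def)
qed (auto simp: truncate_in truncate_ident truncate_add diagram_polys_add algebra_simps)

definition diagram_component :: "nat \<Rightarrow> (nat \<Rightarrow> nat) \<Rightarrow> nat \<Rightarrow> 'k::field_char_0 poly poly set" where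
  "diagram_component n b i = {v \<in> diagram_polys b. homogeneous n i v}"

lemma diagram_finsum:
  assumes b: "antimono b" and "f \<in> A \<rightarrow> diagram_polys b"
  shows "(\<Oplus>\<^bsub>diagram_module b\<^esub>i\<in>A. f i) = (\<Sum>i\<in>A. f i :: 'k::field_char_0 poly poly)"
proof -
  interpret M: Module.module "class_ring :: 'k poly poly ring" "diagram_module b" by (rule diagram_module_module[OF b])
  show ?thesis using assms(2)
  proof (induction A rule: infinite_finite_induct)
    case (insert x A)
    then have "(\<Oplus>\<^bsub>diagram_module b\<^esub>i\<in>insert x A. f i) = f x \<oplus>\<^bsub>diagram_module b\<^esub> (\<Oplus>\<^bsub>diagram_module b\<^esub>i\<in>A. f i)"
      by (intro M.M.finsum_insert) auto
    then show ?case using insert by auto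
  qed simp_all
qed

definition homogeneous_part :: "nat \<Rightarrow> nat \<Rightarrow> 'k::field_char_0 poly poly \<Rightarrow> 'k poly poly" where
  "homogeneous_part n i v = (\<Sum>j\<le>degree v. monom (if n * j \<le> i then monom (coeff (coeff v j) (i - n * j)) (i - n * j) else 0) j)"

lemma coeff_homogeneous_part:
  "coeff (coeff (homogeneous_part n i v) j) a = (if a + n * j = i then coeff (coeff v j) a else 0)"
proof -
  have "coeff (homogeneous_part n i v) j =
    (\<Sum>l\<le>degree v. if l = j then (if n * l \<le> i then monom (coeff (coeff v l) (i - n * l)) (i - n * l) else 0) else 0)"
    by (simp add: homogeneous_part_def coeff_sum)
  also have "\<dots> = (if j \<le> degree v then (if n * j \<le> i then monom (coeff (coeff v j) (i - n * j)) (i - n * j) else 0) else 0)"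
    by (simp add: sum.delta)
  also have "\<dots> = (if n * j \<le> i then monom (coeff (coeff v j) (i - n * j)) (i - n * j) else 0)"
    by (auto simp: coeff_eq_0)
  finally show ?thesis by (auto simp: le_diff_conv)
qed

lemma diagram_module_graded:
  assumes b: "antimono b"
  shows "graded_module n (diagram_module b :: ('k::field_char_0 poly poly, 'k poly poly) module) (diagram_component n b)"
proof (intro graded_module.intro graded_module_axioms.intro)
  let ?M = "diagram_module b :: ('k poly poly, 'k poly poly) module"
  show mod: "Module.module (class_ring :: 'k poly poly ring) ?M" by (rule diagram_module_module[OF b])
  interpret M: Module.module "class_ring :: 'k poly poly ring" ?M by (rule mod)
  show "subgroup (diagram_component n b i) (add_monoid ?M)" for i
  proof (rule group.subgroupI[OF M.M.a_group])
    show "diagram_component n b i \<subseteq> carrier (add_monoid ?M)" by (auto simp: diagram_component_def)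
    have "0 \<in> diagram_component n b i" by (simp add: diagram_component_def diagram_polys_def homogeneous_def)
    then show "diagram_component n b i \<noteq> {}" by blast
    fix v :: "'k poly poly" assume v: "v \<in> diagram_component n b i"
    then have mv: "- v \<in> diagram_component n b i" by (simp add: diagram_component_def diagram_polys_def homogeneous_def)
    have "inv\<^bsub>add_monoid ?M\<^esub> v = - v"
      using v mv by (intro group.inv_equality[OF M.M.a_group]) (auto simp: diagram_component_def)
    then show "inv\<^bsub>add_monoid ?M\<^esub> v \<in> diagram_component n b i" using mv by simp
    fix w :: "'k poly poly" assume w: "w \<in> diagram_component n b i"
    have "homogeneous n i (v + w)"
      unfolding homogeneous_def
    proof (intro allI impI)
      fix a j assume "coeff (coeff (v + w) j) a \<noteq> 0"
      then have "coeff (coeff v j) a \<noteq> 0 \<or> coeff (coeff w j) a \<noteq> 0" by auto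
      then show "a + n * j = i" using v w by (auto simp: diagram_component_def homogeneous_def)
    qed
    then show "v \<otimes>\<^bsub>add_monoid ?M\<^esub> w \<in> diagram_component n b i"
      using v w by (simp add: diagram_component_def diagram_polys_add)
  qed
  show "p \<odot>\<^bsub>?M\<^esub> v \<in> diagram_component n b (e + i)" if "homogeneous n e p" "v \<in> diagram_component n b i" for e i p v
  proof -
    have "homogeneous n (e + i) (p * v)"
      unfolding homogeneous_def
    proof (intro allI impI)
      fix a j assume "coeff (coeff (p * v) j) a \<noteq> 0"
      then have "(\<Sum>l\<le>j. \<Sum>k\<le>a. coeff (coeff p l) k * coeff (coeff v (j - l)) (a - k)) \<noteq> 0"
        by (simp add: coeff_mult coeff_sum)
      then obtain l where l: "l \<le> j" "(\<Sum>k\<le>a. coeff (coeff p l) k * coeff (coeff v (j - l)) (a - k)) \<noteq> 0"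
        by (metis (no_types, lifting) atMost_iff sum.neutral)
      then obtain k where k: "k \<le> a" "coeff (coeff p l) k * coeff (coeff v (j - l)) (a - k) \<noteq> 0"
        by (metis (no_types, lifting) atMost_iff sum.neutral)
      then have "k + n * l = e" "a - k + n * (j - l) = i"
        using that by (auto simp: homogeneous_def diagram_component_def)
      moreover have "n * j = n * l + n * (j - l)" using l(1) by (simp add: distrib_left[symmetric])
      ultimately show "a + n * j = e + i" using k(1) by linarith
    qed
    then have "homogeneous n (e + i) (diagram_truncate b (p * v))"
      by (simp add: homogeneous_def coeff_truncate)
    then show ?thesis by (simp add: diagram_component_def truncate_in)
  qed
  fix v :: "'k poly poly" assume "v \<in> carrier ?M"
  then have v: "v \<in> diagram_polys b" by simp
  let ?h = "\<lambda>i. homogeneous_part n i v"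
  have fsum: "(\<Oplus>\<^bsub>?M\<^esub>i\<in>{i. f i \<noteq> \<zero>\<^bsub>?M\<^esub>}. f i) = (\<Sum>i\<in>{i. f i \<noteq> 0}. f i)"
    if "\<forall>i. f i \<in> diagram_component n b i" for f
    using that by (subst diagram_finsum[OF b]) (auto simp: diagram_component_def)
  have cf: "coeff (coeff (\<Sum>i\<in>{i. f i \<noteq> 0}. f i) j) a = coeff (coeff (f (a + n * j)) j) a"
    if f: "\<forall>i. f i \<in> diagram_component n b i" and fin: "finite {i. f i \<noteq> 0}" for f :: "nat \<Rightarrow> 'k poly poly" and j a
  proof -
    have z: "coeff (coeff (f i) j) a = 0" if "i \<noteq> a + n * j" for i
      using f that by (auto simp: diagram_component_def homogeneous_def)
    have "coeff (coeff (\<Sum>i\<in>{i. f i \<noteq> 0}. f i) j) a = (\<Sum>i\<in>{i. f i \<noteq> 0}. coeff (coeff (f i) j) a)"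
      by (simp add: coeff_sum)
    also have "\<dots> = (\<Sum>i\<in>{a + n * j}. coeff (coeff (f i) j) a)"
      using fin z by (intro sum.mono_neutral_cong) auto
    finally show ?thesis by simp
  qed
  have hc: "\<forall>i. ?h i \<in> diagram_component n b i"
    using v by (auto simp: diagram_component_def diagram_polys_def homogeneous_def coeff_homogeneous_part)
  have hfin: "finite {i. ?h i \<noteq> 0}"
  proof (rule finite_subset)
    show "{i. ?h i \<noteq> 0} \<subseteq> (\<lambda>(j, a). a + n * j) ` (SIGMA j:{..degree v}. {..degree (coeff v j)})"
    proof
      fix i assume "i \<in> {i. ?h i \<noteq> 0}"
      then obtain j a where "coeff (coeff (?h i) j) a \<noteq> 0" by (auto simp: poly_eq_iff)
      then have ja: "a + n * j = i" "coeff (coeff v j) a \<noteq> 0" by (auto simp: coeff_homogeneous_part split: if_splits)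
      then have "j \<le> degree v" "a \<le> degree (coeff v j)" by (auto intro: le_degree)
      then show "i \<in> (\<lambda>(j, a). a + n * j) ` (SIGMA j:{..degree v}. {..degree (coeff v j)})"
        using ja(1) by (intro image_eqI[of _ _ "(j, a)"]) auto
    qed
  qed simp
  have hsum: "v = (\<Sum>i\<in>{i. ?h i \<noteq> 0}. ?h i)"
  proof (intro poly_eqI)
    fix j a
    show "coeff (coeff v j) a = coeff (coeff (\<Sum>i\<in>{i. ?h i \<noteq> 0}. ?h i) j) a"
      unfolding cf[OF hc hfin] coeff_homogeneous_part by simp
  qed
  show "\<exists>!f. (\<forall>i. f i \<in> diagram_component n b i) \<and> finite {i. f i \<noteq> \<zero>\<^bsub>?M\<^esub>} \<and>
      v = (\<Oplus>\<^bsub>?M\<^esub>i\<in>{i. f i \<noteq> \<zero>\<^bsub>?M\<^esub>}. f i)"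
  proof (rule ex1I[of _ ?h])
    show "(\<forall>i. ?h i \<in> diagram_component n b i) \<and> finite {i. ?h i \<noteq> \<zero>\<^bsub>?M\<^esub>} \<and>
      v = (\<Oplus>\<^bsub>?M\<^esub>i\<in>{i. ?h i \<noteq> \<zero>\<^bsub>?M\<^esub>}. ?h i)"
      unfolding fsum[OF hc] using hc hfin hsum by simp
    fix f assume f: "(\<forall>i. f i \<in> diagram_component n b i) \<and> finite {i. f i \<noteq> \<zero>\<^bsub>?M\<^esub>} \<and>
      v = (\<Oplus>\<^bsub>?M\<^esub>i\<in>{i. f i \<noteq> \<zero>\<^bsub>?M\<^esub>}. f i)"
    then have fc: "\<forall>i. f i \<in> diagram_component n b i" by blast
    have ff: "finite {i. f i \<noteq> 0}" and fv: "v = (\<Sum>i\<in>{i. f i \<noteq> 0}. f i)"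
      using f unfolding fsum[OF fc] by simp_all
    show "f = ?h"
    proof
      fix i
      have "coeff (coeff (f i) j) a = coeff (coeff (?h i) j) a" for j a
      proof (cases "a + n * j = i")
        case True
        then show ?thesis using cf[OF fc ff, of j a] by (simp add: fv[symmetric] coeff_homogeneous_part)
      next
        case False
        then show ?thesis using fc by (auto simp: coeff_homogeneous_part diagram_component_def homogeneous_def)
      qed
      then show "f i = ?h i" by (simp add: poly_eq_iff)
    qed
  qed
qed

text \<open>
  Subtracting a multiple of an element of \<open>N\<close> with the same leading monomial lowers the leading
  monomial of an element of \<open>N'\<close>; the lexicographic order on the exponent pairs is a well-order.
\<close>

lemma subspace_eq_if_leading_monomials_eq:
  fixes N N' :: "'k::field_char_0 poly poly set"
  assumes sub: "N \<subseteq> N'" and zero: "0 \<in> N"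
    and add: "\<And>v w. v \<in> N \<Longrightarrow> w \<in> N \<Longrightarrow> v + w \<in> N" and add': "\<And>v w. v \<in> N' \<Longrightarrow> w \<in> N' \<Longrightarrow> v + w \<in> N'"
    and scal: "\<And>c v. v \<in> N \<Longrightarrow> [:[:c:]:] * v \<in> N"
    and lead: "\<And>v c. v \<in> N' \<Longrightarrow> xy_coeff v c \<noteq> 0 \<Longrightarrow> \<forall>c'>c. xy_coeff v c' = 0 \<Longrightarrow>
      \<exists>u\<in>N. xy_coeff u c \<noteq> 0 \<and> (\<forall>c'>c. xy_coeff u c' = 0)"
  shows "N = N'"
proof -
  have finsupp: "finite {c. xy_coeff v c \<noteq> 0}" for v :: "'k poly poly"
  proof (rule finite_subset)
    show "{c. xy_coeff v c \<noteq> 0} \<subseteq> (SIGMA j:{..degree v}. {..degree (coeff v j)})"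
    proof
      fix c assume "c \<in> {c. xy_coeff v c \<noteq> 0}"
      then have "fst c \<le> degree v" "snd c \<le> degree (coeff v (fst c))" by (auto intro: le_degree)
      then show "c \<in> (SIGMA j:{..degree v}. {..degree (coeff v j)})" by (cases c) simp
    qed
  qed simp
  have coeff_scal: "xy_coeff ([:[:a:]:] * v) c = a * xy_coeff v c" for a c and v :: "'k poly poly" by simp
  have "v \<in> N" if "v \<in> N'" "\<forall>c'\<ge>c. xy_coeff v c' = 0" for v c
    using that
  proof (induction c arbitrary: v rule: less_induct)
    case (less c)
    show ?case
    proof (cases "v = 0")
      case False
      then have ne: "{c. xy_coeff v c \<noteq> 0} \<noteq> {}" by (auto simp: poly_eq_iff)
      define c0 where "c0 = Max {c. xy_coeff v c \<noteq> 0}"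
      have c0: "xy_coeff v c0 \<noteq> 0" using Max_in[OF finsupp ne] by (simp add: c0_def)
      have above: "\<forall>c'>c0. xy_coeff v c' = 0"
      proof (intro allI impI)
        fix c' assume "c' > c0"
        then show "xy_coeff v c' = 0" using Max_ge[OF finsupp, of c' v] unfolding c0_def by (meson mem_Collect_eq not_le)
      qed
      have "c0 < c" using c0 less.prems(2) by (meson not_le)
      obtain u where u: "u \<in> N" "xy_coeff u c0 \<noteq> 0" "\<forall>c'>c0. xy_coeff u c' = 0"
        using lead[OF less.prems(1) c0 above] by blast
      \<comment> \<open>The multiple of \<open>u\<close> that cancels the leading coefficient of \<open>v\<close>.\<close>
      define a where "a = xy_coeff v c0 / xy_coeff u c0"
      define w where "w = v + [:[:- a:]:] * u"
      have "w \<in> N'" unfolding w_def using less.prems(1) scal[OF u(1)] sub by (intro add') auto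
      moreover have "\<forall>c'\<ge>c0. xy_coeff w c' = 0"
      proof (intro allI impI)
        fix c' assume "c' \<ge> c0"
        have "xy_coeff w c' = xy_coeff v c' + (- a) * xy_coeff u c'"
          unfolding w_def coeff_add coeff_scal ..
        moreover have "c' = c0 \<or> c' > c0" using \<open>c' \<ge> c0\<close> by auto
        ultimately show "xy_coeff w c' = 0" using above u by (auto simp: a_def)
      qed
      ultimately have "w \<in> N" using less.IH[OF \<open>c0 < c\<close>] by blast
      moreover have "v = w + [:[:a:]:] * u"
        by (auto simp: poly_eq_iff w_def)
      ultimately show ?thesis using add scal[OF u(1)] by blast
    qed (use zero in simp)
  qed
  note main = this
  have "v \<in> N" if "v \<in> N'" for v
  proof (rule main[OF that])
    show "\<forall>c'\<ge>(Suc (degree v), 0). xy_coeff v c' = 0"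
      by (auto simp: less_eq_prod_def coeff_eq_0)
  qed
  then show ?thesis using sub by blast
qed

text \<open>
  Along a descending chain of submodules the sets of leading monomials decrease within the finite
  diagram.  Once they are constant, so is the chain.
\<close>

lemma diagram_module_artinian:
  assumes n: "1 \<le> n" and b: "b \<in> diagrams n d"
  shows "module.artinian (class_ring :: 'k::field_char_0 poly poly ring) (diagram_module b)"
proof -
  have anti: "antimono b" using b by (simp add: diagrams_def)
  interpret M: Module.module "class_ring :: 'k poly poly ring" "diagram_module b" by (rule diagram_module_module[OF anti])
  show ?thesis
    unfolding M.artinian_def
  proof (intro allI impI)
    fix D :: "nat \<Rightarrow> 'k poly poly set"
    assume D: "\<forall>i. LinearCombinations.submodule class_ring (D i) (diagram_module b) \<and> D (Suc i) \<subseteq> D i"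
    define L where "L i = {c. \<exists>v\<in>D i. xy_coeff v c \<noteq> 0 \<and> (\<forall>c'>c. xy_coeff v c' = 0)}" for i
    have Dsub: "D i \<subseteq> diagram_polys b" for i using D LinearCombinations.submodule.subset by fastforce
    have Danti: "D j \<subseteq> D i" if "i \<le> j" for i j using that D by (induction j rule: dec_induct) auto
    have "L i \<subseteq> (SIGMA j:{..d}. {..<b 0})" for i
    proof
      fix c assume "c \<in> L i"
      then obtain v where "v \<in> D i" and v0: "xy_coeff v c \<noteq> 0" unfolding L_def by blast
      then have v: "v \<in> diagram_polys b" using Dsub by blast
      then have "snd c < b (fst c)" using v0 by (auto simp: diagram_polys_def not_le[symmetric])
      moreover have "b (fst c) \<le> b 0" using anti by (simp add: antimonoD)
      moreover have "fst c \<le> d"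
      proof -
        have "b (fst c) + n * fst c \<le> d + 1" using b \<open>snd c < b (fst c)\<close> by (auto simp: diagrams_def)
        moreover have "fst c \<le> n * fst c" using n by simp
        ultimately show ?thesis using \<open>snd c < b (fst c)\<close> by linarith
      qed
      ultimately show "c \<in> (SIGMA j:{..d}. {..<b 0})" by (cases c) simp
    qed
    then have Lfin: "finite (L i)" for i by (rule finite_subset) simp
    have Lanti: "L j \<subseteq> L i" if "i \<le> j" for i j using Danti[OF that] unfolding L_def by blast
    obtain k where k: "\<And>i. card (L k) \<le> card (L i)"
      using ex_has_least_nat[of "\<lambda>_. True" 0 "\<lambda>i. card (L i)"] by auto
    have Leq: "L i = L k" if "k \<le> i" for i
      using card_seteq[OF Lfin Lanti[OF that] k] .
    have "D i = D k" if "k \<le> i" for i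
    proof (rule subspace_eq_if_leading_monomials_eq[OF Danti[OF that]])
      have sm: "LinearCombinations.submodule class_ring (D i) (diagram_module b)" for i using D by blast
      show "0 \<in> D i" using LinearCombinations.submodule.zero_closed[OF sm[of i]] by simp
      show "v + w \<in> D i" if "v \<in> D i" "w \<in> D i" for v w
        using LinearCombinations.submodule.m_closed[OF sm[of i] that] by simp
      show "v + w \<in> D k" if "v \<in> D k" "w \<in> D k" for v w
        using LinearCombinations.submodule.m_closed[OF sm[of k] that] by simp
      show "[:[:c:]:] * v \<in> D i" if "v \<in> D i" for c v
      proof -
        have "v \<in> diagram_polys b" using Dsub that by blast
        then have "[:[:c:]:] * v \<in> diagram_polys b" by (simp add: diagram_polys_def)
        then show ?thesis
          using LinearCombinations.submodule.smult_closed[OF sm[of i] _ that, of "[:[:c:]:]"] by (simp add: truncate_ident)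
      qed
      show "\<exists>u\<in>D i. xy_coeff u c \<noteq> 0 \<and> (\<forall>c'>c. xy_coeff u c' = 0)"
        if "v \<in> D k" "xy_coeff v c \<noteq> 0" "\<forall>c'>c. xy_coeff v c' = 0" for v c
      proof -
        have "c \<in> L k" unfolding L_def using that by blast
        then have "c \<in> L i" using Leq[OF \<open>k \<le> i\<close>] by simp
        then show ?thesis unfolding L_def by blast
      qed
    qed
    then show "\<exists>k. \<forall>i\<ge>k. D i = D k" by blast
  qed
qed

lemma diagram_hilbert_function:
  assumes n: "1 \<le> n" and b: "antimono b"
  shows "hilbert_function (diagram_module b :: ('k::field_char_0 poly poly, 'k poly poly) module) (diagram_component n b) i
    = diagram_count n b i"
proof -
  let ?M = "diagram_module b :: ('k poly poly, 'k poly poly) module"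
  interpret graded_module n ?M "diagram_component n b" by (rule diagram_module_graded[OF b])
  define I where "I = {j. n * j \<le> i \<and> i < b j + n * j}"
  define f where "f j = (xy_monom (i - n * j) j :: 'k poly poly)" for j
  have cf: "coeff (coeff (f j) l) a = (if l = j \<and> a = i - n * j then 1 else 0)" for j l a
    by (simp add: f_def)
  have fin: "finite I" unfolding I_def by (rule finite_rows[OF n])
  have fI: "f ` I \<subseteq> diagram_component n b i"
    by (auto simp: diagram_component_def diagram_polys_def homogeneous_def cf I_def split: if_splits)
  have fP: "f j \<in> diagram_polys b" if "j \<in> I" for j using fI that by (auto simp: diagram_component_def)
  have gen: "diagram_component n b i \<subseteq> kspan ?M (f ` I)"
  proof
    fix v :: "'k poly poly" assume v: "v \<in> diagram_component n b i"
    let ?g = "\<lambda>j. [:[:coeff (coeff v j) (i - n * j):]:] * f j"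
    have "(\<Sum>j\<in>A. ?g j) \<in> kspan ?M (f ` I)" if "finite A" "A \<subseteq> I" for A
      using that
    proof (induction A rule: finite_induct)
      case empty
      show ?case using kspan.zero[of ?M] by simp
    next
      case (insert j A)
      have "?g j \<in> diagram_polys b" using fP[of j] insert.prems by (simp add: diagram_polys_def)
      then show ?case
        using kspan.add[of "f j" "f ` I" "\<Sum>j\<in>A. ?g j" ?M "coeff (coeff v j) (i - n * j)"] insert
        by (simp add: truncate_ident)
    qed
    from this[OF fin order_refl] have "(\<Sum>j\<in>I. ?g j) \<in> kspan ?M (f ` I)" .
    moreover have "v = (\<Sum>j\<in>I. ?g j)"
    proof -
      have "coeff (coeff (\<Sum>j\<in>I. ?g j) l) a = coeff (coeff v l) a" for l a
      proof -
        have "coeff (coeff (\<Sum>j\<in>I. ?g j) l) a = (\<Sum>j\<in>I. coeff (coeff v j) (i - n * j) * (if l = j \<and> a = i - n * j then 1 else 0))"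
          by (simp add: coeff_sum cf)
        also have "\<dots> = (\<Sum>j\<in>I. if j = l then (if a = i - n * l then coeff (coeff v l) a else 0) else 0)"
          by (intro sum.cong) auto
        also have "\<dots> = (if l \<in> I \<and> a = i - n * l then coeff (coeff v l) a else 0)"
          using fin by (simp add: sum.delta)
        also have "\<dots> = coeff (coeff v l) a"
        proof (cases "coeff (coeff v l) a = 0")
          case False
          then have "a + n * l = i" "a < b l"
            using v by (auto simp: diagram_component_def homogeneous_def diagram_polys_def not_le[symmetric])
          then show ?thesis by (auto simp: I_def)
        qed auto
        finally show ?thesis .
      qed
      then show ?thesis by (simp add: poly_eq_iff)
    qed
    ultimately show "v \<in> kspan ?M (f ` I)" by simp
  qed
  have "f x \<notin> kspan ?M (f ` {y \<in> I. y < x})" if x: "x \<in> I" for x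
  proof
    have "coeff (coeff v x) (i - n * x) = 0" if "v \<in> kspan ?M (f ` {y \<in> I. y < x})" for v
      using that
    proof induction
      case (add u v c)
      then obtain y where y: "u = f y" "y < x" by blast
      then show ?case using add.IH by (simp add: coeff_truncate cf)
    qed simp
    moreover assume "f x \<in> kspan ?M (f ` {y \<in> I. y < x})"
    ultimately have "coeff (coeff (f x) x) (i - n * x) = 0" by blast
    then show False by (simp add: cf)
  qed
  then have "{x \<in> I. f x \<notin> kspan ?M (f ` {y \<in> I. y < x})} = I" by blast
  then show ?thesis using hilbert_function_eq_card[OF fin fI gen] by (simp add: I_def diagram_count_def)
qed

lemma diagram_count_h_vector:
  assumes n: "1 \<le> n" and b: "b \<in> diagrams n d"
  shows "diagram_count n b \<in> h_vectors (K :: 'k::field_char_0 itself) n"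
proof -
  let ?M = "diagram_module b :: ('k poly poly, 'k poly poly) module"
  have anti: "antimono b" and b0: "0 < b 0" using b by (auto simp: diagrams_def)
  interpret graded_module n ?M "diagram_component n b" by (rule diagram_module_graded[OF anti])
  have 1: "1 \<in> diagram_component n b 0"
    using b0 by (auto simp: diagram_component_def diagram_polys_def homogeneous_def one_pCons coeff_pCons split: nat.splits)
  have "span {1} = carrier ?M"
  proof
    show "span {1} \<subseteq> carrier ?M" using 1 by (intro span_is_subset2) (auto simp: diagram_component_def)
    show "carrier ?M \<subseteq> span {1}"
    proof
      fix v assume v: "v \<in> carrier ?M"
      have "lincomb (\<lambda>_. v) {1} = v"
        using v 1 by (simp add: lincomb_def diagram_finsum[OF anti] truncate_in truncate_ident)
      then show "v \<in> span {1}" unfolding span_def by (intro CollectI exI[of _ "\<lambda>_. v"] exI[of _ "{1}"]) simp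
    qed
  qed
  then have "fin_gen_degree_0" unfolding fin_gen_degree_0_def using 1 by (intro exI[of _ "{1}"]) simp
  from hilbert_function_in_h_vectors[OF diagram_module_artinian[OF n b] this]
  have "hilbert_function ?M (diagram_component n b) \<in> h_vectors TYPE('k) n" .
  moreover have "hilbert_function ?M (diagram_component n b) = diagram_count n b"
    by (rule ext) (rule diagram_hilbert_function[OF n anti])
  moreover have "h_vectors K n = h_vectors TYPE('k) n" by (simp add: h_vectors_def)
  ultimately show ?thesis by simp
qed

section \<open>The cone of h-vectors\<close>

text \<open>
  An h-vector occurring with positive coefficient in a vector that vanishes above degree \<open>d\<close>
  vanishes there itself, so its standard monomials form diagrams of degree at most \<open>d\<close>.
\<close>

theorem h_cone_upto_eq_diagram_cone:
  assumes n: "1 \<le> n"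
  shows "h_cone_upto (K :: 'k::field_char_0 itself) n d = diagram_cone n d"
proof (intro equalityI subsetI)
  fix v assume v: "v \<in> h_cone_upto K n d"
  then obtain A c where A: "finite A" "A \<subseteq> h_vectors K n" "\<forall>h\<in>A. 0 \<le> c h"
      "v = (\<lambda>i. \<Sum>h\<in>A. c h * of_nat (h i))" and above: "\<forall>i>d. v i = 0"
    unfolding h_cone_upto_def h_cone_def by blast
  have "(\<lambda>i. c h * of_nat (h i)) \<in> diagram_cone n d" if h: "h \<in> A" for h
  proof (cases "c h = 0")
    case False
    have hz: "h i = 0" if "d < i" for i
    proof -
      have "(\<Sum>h\<in>A. c h * of_nat (h i)) = 0" using above A(4) that by simp
      then have "c h * of_nat (h i) = 0"
        using A(1,3) h by (subst (asm) sum_nonneg_eq_0_iff) auto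
      then show ?thesis using False by simp
    qed
    obtain M :: "('k poly poly, (nat \<Rightarrow> 'k poly poly) set) module" and G where M: "h = hilbert_function M G" "graded_module n M G"
      "graded_module.fin_gen_degree_0 M G"
      using A(2) h unfolding h_vectors_def by blast
    interpret graded_module n M G by (rule M(2))
    have "(\<lambda>i. of_nat (h i)) \<in> diagram_cone n d"
      using hilbert_function_eq_sum_diagrams[OF n M(3), of d] hz unfolding M(1) by blast
    then show ?thesis using A(3) h by (intro diagram_cone_scale) auto
  qed (simp add: diagram_cone_zero)
  then show "v \<in> diagram_cone n d" unfolding A(4) by (intro diagram_cone_sum A(1))
next
  fix v assume "v \<in> diagram_cone n d"
  then obtain c where c: "\<forall>b. 0 \<le> c b" "v = (\<lambda>i. \<Sum>b\<in>diagrams n d. c b * diagram_vec n b i)"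
    unfolding diagram_cone_def by blast
  let ?D = "diagrams n d"
  let ?A = "diagram_count n ` ?D"
  \<comment> \<open>Different diagrams may share a Hilbert function, so their coefficients are collected.\<close>
  define c' where "c' h = (\<Sum>b\<in>{b \<in> ?D. diagram_count n b = h}. c b)" for h
  have "v i = (\<Sum>h\<in>?A. c' h * of_nat (h i))" for i
  proof -
    have "v i = (\<Sum>h\<in>?A. \<Sum>b\<in>{b \<in> ?D. diagram_count n b = h}. c b * diagram_vec n b i)"
      unfolding c(2) using sum.image_gen[OF finite_diagrams[OF n], of "\<lambda>b. c b * diagram_vec n b i" d "diagram_count n"] .
    also have "\<dots> = (\<Sum>h\<in>?A. c' h * of_nat (h i))"
      unfolding c'_def sum_distrib_right by (intro sum.cong refl) (auto simp: diagram_vec_def)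
    finally show ?thesis .
  qed
  moreover have "finite ?A" using finite_diagrams[OF n] by simp
  moreover have "?A \<subseteq> h_vectors K n" using diagram_count_h_vector[OF n] by blast
  moreover have "\<forall>h\<in>?A. 0 \<le> c' h" unfolding c'_def using c(1) by (auto intro: sum_nonneg)
  ultimately have "v \<in> h_cone K n" unfolding h_cone_def by blast
  moreover have "v i = 0" if "d < i" for i
    unfolding c(2) using diagram_vec_above[OF n _ that] by (intro sum.neutral) auto
  ultimately show "v \<in> h_cone_upto K n d" unfolding h_cone_upto_def by blast
qed

lemma Ex_points_eq_extremal_upto:
  assumes n: "1 \<le> n"
  shows "Ex_points (K :: 'k::field_char_0 itself) n e = extremal_upto n e"
  unfolding Ex_points_def extremal_upto_def h_cone_upto_eq_diagram_cone[OF n]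
    extremal_rays_diagram_cone[OF n] ..

theorem theorem2p3:
  fixes n m r d :: nat and K :: "'k::field_char_0 itself"
  assumes "1 \<le> n" and "d = n * m + r" and "r \<le> n - 1"
  shows "(d \<le> n - 1 \<longrightarrow> Ex_points K n (int d) = {ones_vec l | l. 1 \<le> l \<and> l \<le> d + 1}) \<and>
    (r + 2 \<le> n \<longrightarrow>
       Ex_points K n (int d) = Ex_points K n (int d - 1) \<union> {s_vec n d} \<union> {t_vec n d} \<union>
         {t_star n d h | h. h \<in> Ex_points K n (int d - 2 * int r - 3)}) \<and>
    (r = n - 1 \<longrightarrow>
       Ex_points K n (int d) = Ex_points K n (int d - 1) \<union> {s_vec n d})"
  unfolding Ex_points_eq_extremal_upto[OF assms(1)]
proof (intro conjI impI)
  show "extremal_upto n (int d) = {ones_vec l | l. 1 \<le> l \<and> l \<le> d + 1}" if "d \<le> n - 1"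
    using extremal_upto_first_row[OF assms(1) that] .
  show "extremal_upto n (int d) = extremal_upto n (int d - 1) \<union> {s_vec n d} \<union> {t_vec n d} \<union>
      {t_star n d h | h. h \<in> extremal_upto n (int d - 2 * int r - 3)}" if "r + 2 \<le> n"
    using extremal_upto_partial_row[OF assms(1,2) that] .
  show "extremal_upto n (int d) = extremal_upto n (int d - 1) \<union> {s_vec n d}" if "r = n - 1"
    using extremal_upto_full_row[OF assms(1,2) that] .
qed

end
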